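(* Let $d\ge 1$, let $\alpha_1,\ldots,\alpha_d$ be positive numbers, let $Q_d=\{-1,1\}^d$ with coordinate-wise multiplication, let $(\rho_v,\ v\in Q_d)$ be $\sigma$-finite measures on $(0,\infty)^d$, and let $(\nu_v^{(i)},\ v\in Q_d)$, $i=1,2$, be two collections of $\sigma$-finite measures on $[0,\infty)^d$. Assume that for some non-empty set $K\subseteq\{1,\ldots,d\}$ the following three conditions hold: (a) $\nu_v^{(i)}(\{\mathbf x:\ x_k=0\text{ for each }k\in K\})=0$ for $i=1,2$ and every $v\in Q_d$; (b) $\int_{(0,\infty)^d}x_j^{\alpha_j}\,\rho_v(d\mathbf x)<\infty$ for each $v\in Q_d$ and $j\in K$; (c) $\sup_{s>0}s^{\alpha_j}\,\nu_v^{(i)}(\{\mathbf x:\ x_j>s\})<\infty$ for $i=1,2$, each $v\in Q_d$ and $j\in K$. Suppose that for each $j\in K$, all $m_1,\ldots,m_d\in\{0,1\}$ and all $\theta_1,\ldots,\theta_d\in\mathbb R$, $$\sum_{v\in Q_d}\prod_{k=1}^d v_k^{m_k}\int_{(0,\infty)^d}x_j^{\alpha_j}\prod_{k=1}^d x_k^{i\theta_k}\,\rho_v(d\mathbf x)\neq 0 .$$ If these measures satisfy the system of $2^d$ equations $$\sum_{w\in Q_d}\nu_w^{(1)}\circledast\rho_{vw}=\sum_{w\in Q_d}\nu_w^{(2)}\circledast\rho_{vw}\qquad\text{for each }v\in Q_d,$$ then $\nu_v^{(1)}=\nu_v^{(2)}$ for each $v\in Q_d$.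
   Context: Notation: $v=(v_1,\ldots,v_d)\in Q_d$, $\mathbf x=(x_1,\ldots,x_d)$; $vw$ is the coordinate-wise product in $Q_d$; in exponents such as $x^{i\theta}$, $i$ is the imaginary unit. For $\sigma$-finite measures $\nu,\rho$ on $\mathbb R^d$ (or on $[0,\infty)^d$, $(0,\infty)^d$, viewed as measures on $\mathbb R^d$), the multiplicative convolution is the (not necessarily $\sigma$-finite) measure $(\nu\circledast\rho)(B)=\int_{\mathbb R^d}\nu(T_{\mathbf x}^{-1}(B))\,\rho(d\mathbf x)$ for Borel $B$, where $T_{\mathbf x}={\rm diag}(\mathbf x)$ acts by coordinate-wise multiplication and $T_{\mathbf x}^{-1}(B)$ is the preimage of $B$. *)

theory Defs
  imports "HOL-Analysis.Analysis"
begin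

definition signs :: "(real ^ 'd) set" where
  "signs = {v. \<forall>k. v $ k \<in> {-1, 1}}"

lemma finite_signs: "finite (signs :: (real ^ 'd) set)"
proof (rule finite_surj)
  show "finite (Pi\<^sub>E (UNIV :: 'd set) (\<lambda>_. {-1, 1 :: real}))"
    by (intro finite_PiE) auto
  show "(signs :: (real ^ 'd) set) \<subseteq> vec_lambda ` Pi\<^sub>E UNIV (\<lambda>_. {-1, 1})"
  proof
    fix v :: "real ^ 'd" assume "v \<in> signs"
    then show "v \<in> vec_lambda ` Pi\<^sub>E UNIV (\<lambda>_. {-1, 1})"
      by (intro image_eqI[of _ _ "vec_nth v"]) (auto simp: signs_def)
  qed
qed

definition pos_orthant :: "(real ^ 'd) set" where
  "pos_orthant = {x. \<forall>k. 0 < x $ k}"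

definition nonneg_orthant :: "(real ^ 'd) set" where
  "nonneg_orthant = {x. \<forall>k. 0 \<le> x $ k}"

(* A sigma-finite measure on S, viewed as a Borel measure on the whole space that gives no mass
   to the complement of S. *)
definition sigma_finite_on :: "(real ^ 'd) set \<Rightarrow> (real ^ 'd) measure \<Rightarrow> bool" where
  "sigma_finite_on S M \<longleftrightarrow>
     sigma_finite_measure M \<and> sets M = sets borel \<and> emeasure M (- S) = 0"

(* On real ^ 'd the operation * is coordinate-wise, so (\<lambda>y. x * y) is diag(x). *)
definition mult_conv ::
  "(real ^ 'd) measure \<Rightarrow> (real ^ 'd) measure \<Rightarrow> (real ^ 'd) measure"  (infixl "\<circledast>" 70) where
  "\<nu> \<circledast> \<rho> = measure_of UNIV (sets borel)
     (\<lambda>B. \<integral>\<^sup>+ x. emeasure \<nu> ((\<lambda>y. x * y) -` B) \<partial>\<rho>)"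

lemma borel_measurable_vec_times [measurable]:
  "(\<lambda>(x, y). x * y :: real ^ 'd) \<in> borel \<Otimes>\<^sub>M borel \<rightarrow>\<^sub>M borel"
proof -
  have "continuous_on UNIV (\<lambda>p :: (real ^ 'd) \<times> (real ^ 'd). \<chi> k. fst p $ k * snd p $ k)"
    by (intro continuous_intros)
  then have "(\<lambda>p :: (real ^ 'd) \<times> (real ^ 'd). \<chi> k. fst p $ k * snd p $ k) \<in> borel_measurable borel"
    by (rule borel_measurable_continuous_onI)
  then show ?thesis
    by (simp add: borel_prod times_vec_def case_prod_unfold)
qed

(* measure_of yields the null measure if its argument is not countably additive; for
   sigma-finite \<nu> this does not happen. *)
lemma emeasure_mult_conv:
  fixes \<nu> \<rho> :: "(real ^ 'd) measure"
  assumes "sigma_finite_measure \<nu>" and sets_\<nu>: "sets \<nu> = sets borel" and sets_\<rho>: "sets \<rho> = sets borel"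
    and B: "B \<in> sets borel"
  shows "emeasure (\<nu> \<circledast> \<rho>) B = (\<integral>\<^sup>+ x. emeasure \<nu> ((\<lambda>y. x * y) -` B) \<partial>\<rho>)"
proof -
  interpret sigma_finite_measure \<nu> by fact
  note [measurable_cong] = sets_\<nu> sets_\<rho>
  have space_eq: "space \<nu> = UNIV" "space \<rho> = UNIV"
    using sets_\<nu> sets_\<rho> by (metis sets_eq_imp_space_eq space_borel)+
  have pre: "(\<lambda>y. x * y) -` A \<in> sets \<nu>" if "A \<in> sets borel" for x :: "real ^ 'd" and A
  proof -
    have "(\<lambda>y. x * y) \<in> borel \<rightarrow>\<^sub>M borel"
      using measurable_compose[OF measurable_Pair1'[of x borel borel] borel_measurable_vec_times]
      by simp
    from measurable_sets[OF this that] show ?thesis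
      by (simp add: sets_\<nu>)
  qed
  have meas: "(\<lambda>x. emeasure \<nu> ((\<lambda>y. x * y) -` A)) \<in> borel_measurable \<rho>"
    if A: "A \<in> sets borel" for A
  proof -
    have "(\<lambda>(x, y). x * y) -` A \<inter> space (\<rho> \<Otimes>\<^sub>M \<nu>) \<in> sets (\<rho> \<Otimes>\<^sub>M \<nu>)"
      by (rule measurable_sets[OF _ A]) measurable
    from measurable_emeasure_Pair[OF this] show ?thesis
      by (simp add: space_pair_measure space_eq vimage_def)
  qed
  show ?thesis
    unfolding mult_conv_def
  proof (rule emeasure_measure_of_sigma)
    show "sigma_algebra UNIV (sets (borel :: (real ^ 'd) measure))"
      using sets.sigma_algebra_axioms[of "borel :: (real ^ 'd) measure"] by simp
    show "positive (sets borel) (\<lambda>B. \<integral>\<^sup>+ x. emeasure \<nu> ((\<lambda>y. x * y) -` B) \<partial>\<rho>)"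
      by (simp add: positive_def)
    show "countably_additive (sets borel) (\<lambda>B. \<integral>\<^sup>+ x. emeasure \<nu> ((\<lambda>y. x * y) -` B) \<partial>\<rho>)"
    proof (rule countably_additiveI)
      fix A :: "nat \<Rightarrow> (real ^ 'd) set"
      assume A: "range A \<subseteq> sets borel" "disjoint_family A"
      have "(\<Sum>i. \<integral>\<^sup>+ x. emeasure \<nu> ((\<lambda>y. x * y) -` A i) \<partial>\<rho>)
          = (\<integral>\<^sup>+ x. (\<Sum>i. emeasure \<nu> ((\<lambda>y. x * y) -` A i)) \<partial>\<rho>)"
        using A by (intro nn_integral_suminf [symmetric] meas) auto
      also have "\<dots> = (\<integral>\<^sup>+ x. emeasure \<nu> ((\<lambda>y. x * y) -` (\<Union>i. A i)) \<partial>\<rho>)"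
      proof (rule nn_integral_cong)
        fix x :: "real ^ 'd"
        have "(\<Sum>i. emeasure \<nu> ((\<lambda>y. x * y) -` A i)) = emeasure \<nu> (\<Union>i. (\<lambda>y. x * y) -` A i)"
          using A pre by (intro suminf_emeasure) (auto simp: disjoint_family_on_def)
        then show "(\<Sum>i. emeasure \<nu> ((\<lambda>y. x * y) -` A i)) = emeasure \<nu> ((\<lambda>y. x * y) -` (\<Union>i. A i))"
          by (simp add: vimage_UN)
      qed
      finally show "(\<Sum>i. \<integral>\<^sup>+ x. emeasure \<nu> ((\<lambda>y. x * y) -` A i) \<partial>\<rho>)
          = (\<integral>\<^sup>+ x. emeasure \<nu> ((\<lambda>y. x * y) -` (\<Union>i. A i)) \<partial>\<rho>)" .
    qed
  qed (use B in auto)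
qed

end

theory Submission
  imports Defs "HOL-Probability.Characteristic_Functions"
begin

text \<open>
  Fix \<open>j \<in> K\<close> and pass to logarithmic coordinates. Weighted by \<open>x\<^sub>j powr \<alpha>\<^sub>j\<close>, the measures
  \<open>\<rho>\<^sub>v\<close> become finite, whereas the measures \<open>\<nu>\<^sub>v\<close> only become bounded on unit slabs in direction \<open>j\<close>.
  A character of the sign group decouples the system into equations \<open>\<sigma> * \<rho> = 0\<close>, where the
  transform of \<open>\<rho>\<close> has no zeros, so a Tauberian theorem of Wiener type is needed in direction \<open>j\<close>.
  It is proved with Gaussian means: if \<open>M(t, s)\<close> is the supremum of \<open>e\<^sup>i\<^sup>s\<^sup>y \<sigma>\<close> convolved with the Gaussian
  of variance \<open>t\<close>, then translates of wide Gaussians are close in \<open>L\<^sup>1\<close>, whence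
  \<open>|\<rho>(s)| M(2t, s) \<le> \<epsilon>(t) M(t, s)\<close> for the transform \<open>\<rho>(s)\<close>, with \<open>\<epsilon>(t) \<rightarrow> 0\<close>. Iterating,
  \<open>M(2\<^sup>k, s) = O(2\<^sup>-\<^sup>k)\<close> uniformly on compact sets of frequencies \<open>s\<close>, which beats the normalising
  factor \<open>2\<^sup>k\<^sup>/\<^sup>2\<close> of the Gaussian and forces \<open>\<sigma>\<close> to annihilate every kernel with compactly supported
  Fourier transform. With a positive such kernel as an additional weight the \<open>\<nu>\<^sub>v\<close> become finite measures
  with equal Mellin transforms on every coordinate face, and uniqueness of transforms applies.
\<close>

section \<open>Gaussian kernels\<close>

text \<open>The Tauberian part stays one-dimensional whatever the dimension: the coordinates other
  than j enter only through unimodular characters, which are multiplicative and can be absorbed into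
  the complex weights \<open>H\<close> and \<open>W\<close>. Hence it is stated for arbitrary
  measure spaces carrying real functions \<open>Y\<close> and \<open>Z\<close>. A frequency s in
  direction j merely shifts theta_j, so the non-vanishing hypothesis covers every s. The obstacle is
  that eps(t) tends to 0 without a rate, because the weighted rho is just a finite measure, with no
  moments in the logarithmic coordinate. The rate comes from the iteration alone: on a compact set
  of frequencies the transform is at least some c > 0 in modulus, and once eps(t) is at most c/2,
  each doubling of t halves the mean. This is where compact support of the Fourier transform of the
  kernel is used. Faces appear because logarithms break down at vanishing coordinates;
  multiplication by a point of the open orthant never changes which coordinates vanish, so the faces
  do not interact. One index j only reaches the region where x_j > 0; letting j run through K leaves
  exactly the set that condition (a) makes null.\<close>

lemma (in pair_sigma_finite) integrable_pairI:
  fixes f :: "_ \<Rightarrow> _::{banach, second_countable_topology}"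
  assumes [measurable]: "f \<in> borel_measurable (M1 \<Otimes>\<^sub>M M2)"
    and k: "integrable M1 k"
    and bound: "AE x in M1. (\<integral>\<^sup>+ y. norm (f (x, y)) \<partial>M2) \<le> ennreal (k x)"
  shows "integrable (M1 \<Otimes>\<^sub>M M2) f"
proof (rule integrableI_bounded)
  have "(\<integral>\<^sup>+ p. norm (f p) \<partial>(M1 \<Otimes>\<^sub>M M2)) = (\<integral>\<^sup>+ x. (\<integral>\<^sup>+ y. norm (f (x, y)) \<partial>M2) \<partial>M1)"
    by (simp add: M2.nn_integral_fst [symmetric])
  also have "\<dots> \<le> (\<integral>\<^sup>+ x. ennreal (k x) \<partial>M1)"
    using bound by (rule nn_integral_mono_AE)
  also have "\<dots> \<le> (\<integral>\<^sup>+ x. ennreal (norm (k x)) \<partial>M1)"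
    by (intro nn_integral_mono ennreal_leI) auto
  also have "\<dots> < \<infinity>"
    using k by (simp add: integrable_iff_bounded)
  finally show "(\<integral>\<^sup>+ p. norm (f p) \<partial>(M1 \<Otimes>\<^sub>M M2)) < \<infinity>" .
qed fact

definition gauss :: "real \<Rightarrow> real \<Rightarrow> real" where
  "gauss t = normal_density 0 (sqrt t)"

lemma gauss_eq: "t > 0 \<Longrightarrow> gauss t y = exp (- y\<^sup>2 / (2 * t)) / sqrt (2 * pi * t)"
  by (simp add: gauss_def normal_density_def)

lemma gauss_measurable [measurable]: "gauss t \<in> borel_measurable borel"
  by (simp add: gauss_def)

lemma gauss_nonneg [simp]: "gauss t y \<ge> 0"
  by (simp add: gauss_def)

lemma gauss_minus [simp]: "gauss t (- y) = gauss t y"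
  by (simp add: gauss_def normal_density_def)

lemma integrable_gauss [simp]: "t > 0 \<Longrightarrow> integrable lborel (gauss t)"
  by (simp add: gauss_def)

lemma integral_gauss [simp]: "t > 0 \<Longrightarrow> (\<integral>y. gauss t y \<partial>lborel) = 1"
  by (simp add: gauss_def)

text \<open>From \<open>1 + x \<le> exp x\<close>, which turns the exponential into rational decay.
  Quadratic decay is the common currency below: it is summable over unit slabs.\<close>

lemma gauss_le:
  assumes "t > 0"
  shows "gauss t y \<le> (max 1 (2 * t) / sqrt (2 * pi * t)) / (1 + y\<^sup>2)"
proof -
  have "exp (- y\<^sup>2 / (2 * t)) = inverse (exp (y\<^sup>2 / (2 * t)))"
    by (simp add: exp_minus[symmetric])
  also have "\<dots> \<le> inverse (1 + y\<^sup>2 / (2 * t))"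
    using assms by (intro le_imp_inverse_le exp_ge_add_one_self) (auto intro: add_pos_nonneg)
  also have "\<dots> \<le> max 1 (2 * t) / (1 + y\<^sup>2)"
  proof -
    have "(1 + y\<^sup>2) / max 1 (2 * t) \<le> 1 + y\<^sup>2 / (2 * t)"
      unfolding add_divide_distrib using assms
      by (intro add_mono divide_left_mono) auto
    then have "inverse (1 + y\<^sup>2 / (2 * t)) \<le> inverse ((1 + y\<^sup>2) / max 1 (2 * t))"
      using assms by (intro le_imp_inverse_le) (auto intro!: divide_pos_pos add_pos_nonneg)
    then show ?thesis by simp
  qed
  finally show ?thesis
    using divide_right_mono[of _ "max 1 (2 * t) / (1 + y\<^sup>2)" "sqrt (2 * pi * t)"] assms
    by (simp add: gauss_eq mult.commute)
qed

lemma gauss_conv: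
  assumes "t > 0"
  shows "(\<integral>r. gauss t r * gauss t (a - r) \<partial>lborel) = gauss (2 * t) a"
proof -
  have "(\<integral>\<^sup>+r. ennreal (gauss t (a - r) * gauss t r) \<partial>lborel) = ennreal (gauss (2 * t) a)"
    using fun_cong[OF conv_normal_density_zero_mean[of "sqrt t" "sqrt t"], of a] assms
    by (simp add: gauss_def)
  then have "(\<integral>r. gauss t (a - r) * gauss t r \<partial>lborel) = gauss (2 * t) a"
    by (subst integral_eq_nn_integral) auto
  then show ?thesis by (simp add: mult.commute)
qed

text \<open>\<^term>\<open>1 + x \<le> exp x\<close> bounds the positive part of
  \<^term>\<open>gauss t r - gauss t (r - z)\<close>, which carries half of the \<open>L\<^sup>1\<close> norm.\<close>

lemma gauss_shift:
  assumes "t > 0"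
  shows "(\<integral>r. \<bar>gauss t r - gauss t (r - z)\<bar> \<partial>lborel) \<le> min 2 (z\<^sup>2 / t + 2 * \<bar>z\<bar> / sqrt t)"
proof -
  have int [simp]: "integrable lborel (\<lambda>r. gauss t (r - z))"
    using lborel_integrable_real_affine[of "gauss t" 1 "-z"] assms by (simp add: algebra_simps)
  have tot: "(\<integral>r. gauss t (r - z) \<partial>lborel) = 1"
    using lborel_integral_real_affine[of 1 "gauss t" "-z"] assms by (simp add: algebra_simps)
  \<comment> \<open>If d \<le> e and e \<ge> 0, then |d| \<le> 2 e - d. Here d is the difference of
    the two Gaussians, so the last summand integrates to 0 and only moments of a Gaussian centred at
    0 remain.\<close>
  have pw: "\<bar>gauss t r - gauss t (r - z)\<bar> \<le>
      (z\<^sup>2 / t) * gauss t r + (2 * \<bar>z\<bar> / t) * (gauss t r * \<bar>r\<bar>) + (gauss t (r - z) - gauss t r)" for r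
  proof -
    have "gauss t (r - z) = gauss t r * exp (r * z / t - z\<^sup>2 / (2 * t))"
      using assms by (simp add: gauss_eq exp_add[symmetric] field_simps power2_eq_square)
    also have "\<dots> \<ge> gauss t r * (1 + (r * z / t - z\<^sup>2 / (2 * t)))"
      by (intro mult_left_mono exp_ge_add_one_self) auto
    also have "gauss t r * (1 + (r * z / t - z\<^sup>2 / (2 * t))) \<ge>
        gauss t r * (1 - \<bar>r\<bar> * \<bar>z\<bar> / t - z\<^sup>2 / (2 * t))"
    proof (intro mult_left_mono)
      have "- (\<bar>r\<bar> * \<bar>z\<bar>) \<le> r * z" by (metis abs_ge_minus_self abs_mult minus_le_iff)
      then have "- (\<bar>r\<bar> * \<bar>z\<bar>) / t \<le> r * z / t" using assms by (intro divide_right_mono) auto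
      then show "1 - \<bar>r\<bar> * \<bar>z\<bar> / t - z\<^sup>2 / (2 * t) \<le> 1 + (r * z / t - z\<^sup>2 / (2 * t))" by simp
    qed auto
    finally have 1: "gauss t r - gauss t (r - z) \<le> gauss t r * (\<bar>r\<bar> * \<bar>z\<bar> / t + z\<^sup>2 / (2 * t))"
      by (simp add: algebra_simps)
    have 2: "0 \<le> gauss t r * (\<bar>r\<bar> * \<bar>z\<bar> / t + z\<^sup>2 / (2 * t))"
      using assms by (intro mult_nonneg_nonneg add_nonneg_nonneg) auto
    have "2 * (gauss t r * (\<bar>r\<bar> * \<bar>z\<bar> / t + z\<^sup>2 / (2 * t))) =
       (z\<^sup>2 / t) * gauss t r + (2 * \<bar>z\<bar> / t) * (gauss t r * \<bar>r\<bar>)"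
      using assms by (simp add: field_simps)
    then show ?thesis using 1 2 by linarith
  qed
  have "sqrt (2 / pi) \<le> 1" using pi_gt3 by simp
  then have mom: "(\<integral>r. gauss t r * \<bar>r\<bar> \<partial>lborel) \<le> sqrt t"
    using integral_normal_moment_abs_odd[of "sqrt t" 0 0] assms mult_left_mono[of "sqrt (2 / pi)" 1 "sqrt t"]
    by (simp add: gauss_def)
  have [simp]: "integrable lborel (\<lambda>r. gauss t r * \<bar>r\<bar>)"
    using integrable_normal_moment_abs[of "sqrt t" 0 1] assms by (simp add: gauss_def)
  note [simp] = integrable_gauss[OF assms]
  have "(\<integral>r. \<bar>gauss t r - gauss t (r - z)\<bar> \<partial>lborel) \<le>
     (\<integral>r. (z\<^sup>2 / t) * gauss t r + (2 * \<bar>z\<bar> / t) * (gauss t r * \<bar>r\<bar>) + (gauss t (r - z) - gauss t r) \<partial>lborel)"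
    by (intro integral_mono pw) auto
  also have "\<dots> = z\<^sup>2 / t + (2 * \<bar>z\<bar> / t) * (\<integral>r. gauss t r * \<bar>r\<bar> \<partial>lborel)"
    using assms tot by simp
  also have "\<dots> \<le> z\<^sup>2 / t + (2 * \<bar>z\<bar> / t) * sqrt t"
    using assms mom by (intro add_left_mono mult_left_mono) auto
  also have "\<dots> = z\<^sup>2 / t + 2 * \<bar>z\<bar> / sqrt t"
    using assms real_div_sqrt[of t] by (simp add: field_simps)
  finally have a: "(\<integral>r. \<bar>gauss t r - gauss t (r - z)\<bar> \<partial>lborel) \<le> z\<^sup>2 / t + 2 * \<bar>z\<bar> / sqrt t" .
  \<comment> \<open>The trivial bound 2 is what later permits averaging over shifts z that have no
    moments.\<close>
  have "(\<integral>r. \<bar>gauss t r - gauss t (r - z)\<bar> \<partial>lborel) \<le> (\<integral>r. gauss t r + gauss t (r - z) \<partial>lborel)"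
    by (intro integral_mono) (auto intro: order_trans[OF abs_triangle_ineq4])
  also have "\<dots> = 2" using assms tot by simp
  finally show ?thesis using a by simp
qed

section \<open>Integration against measures bounded on unit slabs\<close>

lemma summable_inverse_one_plus_square: "summable (\<lambda>n. 1 / (1 + (real n)\<^sup>2))"
proof (rule summable_comparison_test_ev)
  show "summable (\<lambda>n. inverse ((real n)\<^sup>2))"
    by (rule inverse_power_summable) auto
  show "\<forall>\<^sub>F n in sequentially. norm (1 / (1 + (real n)\<^sup>2)) \<le> inverse ((real n)\<^sup>2)"
    using eventually_gt_at_top[of 0] by eventually_elim (simp add: inverse_eq_divide frac_le)
qed

definition sq_sum :: real where "sq_sum = (\<Sum>n. 1 / (1 + (real n)\<^sup>2))"

lemma sq_sum_nonneg: "sq_sum \<ge> 0"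
  unfolding sq_sum_def by (intro suminf_nonneg summable_inverse_one_plus_square) auto

lemma Peetre: "1 + (y::real)\<^sup>2 \<le> 2 * (1 + a\<^sup>2) * (1 + (y - a)\<^sup>2)"
proof -
  \<comment> \<open>This sum is exactly the right-hand side minus the left-hand side.\<close>
  have "0 \<le> (y - 2 * a)\<^sup>2 + 2 * (a * (y - a))\<^sup>2 + 1" by simp
  then show ?thesis by (simp add: power2_eq_square algebra_simps)
qed

text \<open>The image of \<open>H\<close> times \<open>N\<close> under \<open>Y\<close> is a
  translation-bounded complex measure on the line, possibly of infinite total mass. Keeping the
  triple \<open>N\<close>, \<open>Y\<close>, \<open>H\<close> avoids complex measures as objects and
  leaves room in \<open>H\<close> for characters of the other coordinates.\<close>

locale slab_bounded = sigma_finite_measure N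
  for N :: "'a measure" +
  fixes Y :: "'a \<Rightarrow> real" and H :: "'a \<Rightarrow> complex" and D :: real
  assumes Y [measurable]: "Y \<in> borel_measurable N"
    and H [measurable]: "H \<in> borel_measurable N"
    and D: "D \<ge> 0"
    and slab: "\<And>t. (\<integral>\<^sup>+ x. ennreal (norm (H x)) * indicator {t..t+1} (Y x) \<partial>N) \<le> ennreal D"
begin

text \<open>Cut the line into unit slabs at distance n on either side of \<open>a\<close>; the
  factor 2 counts the two sides. The bound does not depend on \<open>a\<close>, which every later
  use of Fubini relies on.\<close>

lemma nn_integral_weight_le:
  "(\<integral>\<^sup>+ x. ennreal (norm (H x) * (1 / (1 + (Y x - a)\<^sup>2))) \<partial>N) \<le> ennreal (2 * D * sq_sum)"
proof -
  let ?c = "\<lambda>n. 1 / (1 + (real n)\<^sup>2)"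
  let ?g = "\<lambda>n x. ennreal (?c n) * (ennreal (norm (H x)) * indicator {a + n..a + n + 1} (Y x)
      + ennreal (norm (H x)) * indicator {a - n - 1..a - n - 1 + 1} (Y x))"
  have pw: "ennreal (norm (H x) * (1 / (1 + (Y x - a)\<^sup>2))) \<le> (\<Sum>n. ?g n x)" for x
  proof -
    define n where "n = nat \<lfloor>\<bar>Y x - a\<bar>\<rfloor>"
    have n: "real n \<le> \<bar>Y x - a\<bar>" "\<bar>Y x - a\<bar> \<le> real n + 1"
      unfolding n_def by linarith+
    then have "(real n)\<^sup>2 \<le> (Y x - a)\<^sup>2"
      using power_mono[of "real n" "\<bar>Y x - a\<bar>" 2] by simp
    then have "1 / (1 + (Y x - a)\<^sup>2) \<le> ?c n"
      by (intro divide_left_mono) (auto intro!: mult_pos_pos add_pos_nonneg)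
    then have "ennreal (norm (H x) * (1 / (1 + (Y x - a)\<^sup>2))) \<le> ennreal (norm (H x) * ?c n)"
      by (intro ennreal_leI mult_left_mono) auto
    also have "\<dots> = ennreal (?c n) * ennreal (norm (H x))"
      by (subst ennreal_mult[symmetric]) (auto simp: mult.commute)
    also have "\<dots> \<le> ?g n x"
    proof (rule mult_left_mono)
      consider "Y x \<in> {a + n..a + n + 1}" | "Y x \<in> {a - n - 1..a - n - 1 + 1}"
        using n by (force simp: abs_if split: if_splits)
      then show "ennreal (norm (H x)) \<le> ennreal (norm (H x)) * indicator {a + n..a + n + 1} (Y x)
          + ennreal (norm (H x)) * indicator {a - n - 1..a - n - 1 + 1} (Y x)"
        by cases (simp_all only: indicator_simps mult_1_right, auto)
    qed auto
    also have "\<dots> \<le> (\<Sum>n. ?g n x)"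
      using sum_le_suminf[of "\<lambda>n. ?g n x" "{n}"] by (simp add: summableI)
    finally show ?thesis .
  qed
  have "(\<integral>\<^sup>+ x. ennreal (norm (H x) * (1 / (1 + (Y x - a)\<^sup>2))) \<partial>N) \<le> (\<integral>\<^sup>+ x. (\<Sum>n. ?g n x) \<partial>N)"
    by (intro nn_integral_mono pw)
  also have "\<dots> = (\<Sum>n. \<integral>\<^sup>+ x. ?g n x \<partial>N)"
    by (rule nn_integral_suminf) measurable
  also have "\<dots> \<le> (\<Sum>n. ennreal (2 * D * ?c n))"
  proof (intro suminf_le summableI)
    fix n
    have "(\<integral>\<^sup>+ x. ?g n x \<partial>N) = ennreal (?c n) *
      ((\<integral>\<^sup>+ x. ennreal (norm (H x)) * indicator {a + n..a + n + 1} (Y x) \<partial>N) +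
       (\<integral>\<^sup>+ x. ennreal (norm (H x)) * indicator {a - n - 1..a - n - 1 + 1} (Y x) \<partial>N))"
      by (subst nn_integral_cmult, measurable, subst nn_integral_add, measurable)
    also have "\<dots> \<le> ennreal (?c n) * (ennreal D + ennreal D)"
      by (intro mult_left_mono add_mono slab) auto
    also have "\<dots> = ennreal (?c n * (D + D))"
      using ennreal_plus[OF D D] ennreal_mult[of "?c n" "D + D"] D by simp
    finally show "(\<integral>\<^sup>+ x. ?g n x \<partial>N) \<le> ennreal (2 * D * ?c n)"
      by (simp add: mult_ac)
  qed
  also have "\<dots> = ennreal (\<Sum>n. 2 * D * ?c n)"
    using D summable_mult[OF summable_inverse_one_plus_square, of "2 * D"]
    by (intro suminf_ennreal2) auto
  also have "(\<Sum>n. 2 * D * ?c n) = 2 * D * sq_sum"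
    unfolding sq_sum_def by (rule suminf_mult[OF summable_inverse_one_plus_square])
  finally show ?thesis .
qed

lemma nn_integral_le:
  assumes b: "\<And>y. norm (\<phi> y :: complex) \<le> C / (1 + (y - a)\<^sup>2)"
  shows "(\<integral>\<^sup>+ x. norm (\<phi> (Y x) * H x) \<partial>N) \<le> ennreal (2 * C * D * sq_sum)"
proof -
  have C: "C \<ge> 0" using order_trans[OF norm_ge_zero b, of a] by simp
  have "(\<integral>\<^sup>+ x. norm (\<phi> (Y x) * H x) \<partial>N) \<le>
      (\<integral>\<^sup>+ x. ennreal C * ennreal (norm (H x) * (1 / (1 + (Y x - a)\<^sup>2))) \<partial>N)"
    using C mult_right_mono[OF b norm_ge_zero]
    by (intro nn_integral_mono, subst ennreal_mult[symmetric])
      (auto simp: norm_mult mult_ac intro!: ennreal_leI)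
  also have "\<dots> = ennreal C * (\<integral>\<^sup>+ x. ennreal (norm (H x) * (1 / (1 + (Y x - a)\<^sup>2))) \<partial>N)"
    by (rule nn_integral_cmult) measurable
  also have "\<dots> \<le> ennreal C * ennreal (2 * D * sq_sum)"
    by (intro mult_left_mono nn_integral_weight_le) auto
  also have "\<dots> = ennreal (2 * C * D * sq_sum)"
    using C D sq_sum_nonneg by (subst ennreal_mult[symmetric]) (auto simp: mult_ac)
  finally show ?thesis .
qed

lemma integrable_weight:
  assumes [measurable]: "\<phi> \<in> borel_measurable borel"
    and b: "\<And>y. norm (\<phi> y :: complex) \<le> C / (1 + (y - a)\<^sup>2)"
  shows "integrable N (\<lambda>x. \<phi> (Y x) * H x)"
  using nn_integral_le[OF b] by (intro integrableI_bounded) (auto simp: le_less_trans)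

lemma norm_integral_le:
  assumes [measurable]: "\<phi> \<in> borel_measurable borel"
    and b: "\<And>y. norm (\<phi> y :: complex) \<le> C / (1 + (y - a)\<^sup>2)"
  shows "norm (\<integral>x. \<phi> (Y x) * H x \<partial>N) \<le> 2 * C * D * sq_sum"
proof -
  have C: "C \<ge> 0" using order_trans[OF norm_ge_zero b, of a] by simp
  have "ennreal (norm (\<integral>x. \<phi> (Y x) * H x \<partial>N)) \<le> (\<integral>\<^sup>+ x. norm (\<phi> (Y x) * H x) \<partial>N)"
    by (rule integral_norm_bound_ennreal[OF integrable_weight[OF assms]])
  also note nn_integral_le[OF b]
  finally show ?thesis
    using C D sq_sum_nonneg by (subst (asm) ennreal_le_iff) auto
qed

end

section \<open>A Tauberian theorem of Wiener type\<close>

lemma norm_integral_le_integral: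
  fixes f :: "'a \<Rightarrow> 'b :: {banach, second_countable_topology}"
  assumes "integrable M f" "integrable M g" "\<And>x. norm (f x) \<le> g x"
  shows "norm (integral\<^sup>L M f) \<le> integral\<^sup>L M g"
  using assms by (intro order_trans[OF integral_norm_bound] integral_mono integrable_norm)

text \<open>The phase is \<open>cis (s * y)\<close>, not \<open>cis (s * (a - y))\<close>: the
  measure is modulated and then smoothed, so moving the centre \<open>a\<close> leaves the phase
  alone and the Gaussian semigroup law survives for each fixed \<open>s\<close>.\<close>

definition gauss_kernel :: "real \<Rightarrow> real \<Rightarrow> real \<Rightarrow> real \<Rightarrow> complex" where
  "gauss_kernel t s a y = complex_of_real (gauss t (a - y)) * cis (s * y)"

lemma gauss_kernel_measurable [measurable]:
  "(\<lambda>x. gauss_kernel t s (f x) (g x)) \<in> borel_measurable M"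
  if [measurable]: "f \<in> borel_measurable M" "g \<in> borel_measurable M"
  unfolding gauss_kernel_def cis_conv_exp by measurable

definition gauss_const :: "real \<Rightarrow> real" where
  "gauss_const t = max 1 (2 * t) / sqrt (2 * pi * t)"

lemma norm_gauss_kernel_le:
  "t > 0 \<Longrightarrow> norm (gauss_kernel t s a y) \<le> gauss_const t / (1 + (y - a)\<^sup>2)"
  using gauss_le[of t "a - y"]
  by (simp add: gauss_kernel_def norm_mult gauss_const_def power2_commute[of y])

text \<open>A substitution moves the translation by \<open>z\<close> from \<open>u\<close> onto the
  Gaussian. Then \<open>u\<close> enters only through its bound \<open>M\<close>, and
  \<open>gauss_shift\<close> gives the rest.\<close>

lemma gauss_mean_shift:
  fixes u :: "real \<Rightarrow> complex"
  assumes [measurable]: "u \<in> borel_measurable borel" and u: "\<And>b. norm (u b) \<le> M" and t: "t > 0"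
  shows "norm ((\<integral>r. gauss t r * u (a - r) \<partial>lborel) - (\<integral>r. gauss t r * u (a - z - r) \<partial>lborel))
    \<le> M * min 2 (z\<^sup>2 / t + 2 * \<bar>z\<bar> / sqrt t)"
proof -
  have M: "M \<ge> 0" using order_trans[OF norm_ge_zero u[of 0]] .
  have int: "integrable lborel (\<lambda>r. gauss t r * u (b - r))" for b
  proof (rule Bochner_Integration.integrable_bound)
    show "integrable lborel (\<lambda>r. M * gauss t r)" using t by simp
    show "AE r in lborel. norm (gauss t r * u (b - r)) \<le> norm (M * gauss t r)"
      using M u by (auto simp: norm_mult mult.commute[of M] intro!: mult_left_mono AE_I2)
  qed measurable
  have shift: "(\<integral>r. gauss t r * u (a - z - r) \<partial>lborel) = (\<integral>r. gauss t (r - z) * u (a - r) \<partial>lborel)"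
    using lborel_integral_real_affine[of 1 "\<lambda>r. gauss t r * u (a - z - r)" "-z"]
    by (simp add: algebra_simps)
  have int': "integrable lborel (\<lambda>r. gauss t (r - z) * u (a - r))"
    using lborel_integrable_real_affine[OF int[of "a - z"], of 1 "-z"]
    by (simp add: algebra_simps)
  have intg: "integrable lborel (\<lambda>r. gauss t r - gauss t (r - z))"
    using lborel_integrable_real_affine[OF integrable_gauss[OF t], of 1 "-z"] t
    by (simp add: algebra_simps)
  have "norm ((\<integral>r. gauss t r * u (a - r) \<partial>lborel) - (\<integral>r. gauss t r * u (a - z - r) \<partial>lborel))
      = norm (\<integral>r. gauss t r * u (a - r) - gauss t (r - z) * u (a - r) \<partial>lborel)"
    unfolding shift using int int' by simp
  also have "\<dots> \<le> (\<integral>r. M * \<bar>gauss t r - gauss t (r - z)\<bar> \<partial>lborel)"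
  proof (rule norm_integral_le_integral)
    show "integrable lborel (\<lambda>r. gauss t r * u (a - r) - gauss t (r - z) * u (a - r))"
      using int int' by simp
    show "integrable lborel (\<lambda>r. M * \<bar>gauss t r - gauss t (r - z)\<bar>)"
      using intg by simp
    fix r
    have "gauss t r * u (a - r) - gauss t (r - z) * u (a - r) = (gauss t r - gauss t (r - z)) * u (a - r)"
      by (simp add: algebra_simps)
    then have "norm (gauss t r * u (a - r) - gauss t (r - z) * u (a - r))
        = \<bar>gauss t r - gauss t (r - z)\<bar> * norm (u (a - r))"
      by (simp only: norm_mult norm_of_real)
    also have "\<dots> \<le> M * \<bar>gauss t r - gauss t (r - z)\<bar>"
      using u by (simp add: mult.commute[of M] mult_left_mono)
    finally show "norm (gauss t r * u (a - r) - gauss t (r - z) * u (a - r))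
        \<le> M * \<bar>gauss t r - gauss t (r - z)\<bar>" .
  qed
  also have "\<dots> = M * (\<integral>r. \<bar>gauss t r - gauss t (r - z)\<bar> \<partial>lborel)"
    by simp
  also have "\<dots> \<le> M * min 2 (z\<^sup>2 / t + 2 * \<bar>z\<bar> / sqrt t)"
    using M gauss_shift[OF t] by (rule mult_left_mono[rotated])
  finally show ?thesis .
qed

context slab_bounded
begin

lemma norm_integral_gauss_kernel:
  "t > 0 \<Longrightarrow> norm (\<integral>x. gauss_kernel t s a (Y x) * H x \<partial>N) \<le> 2 * gauss_const t * D * sq_sum"
  by (rule norm_integral_le[OF _ norm_gauss_kernel_le]) measurable

text \<open>The semigroup law \<open>gauss_conv\<close> under the integral sign. Fubini applies
  since the inner integral is bounded uniformly in the centre \<open>a - r\<close>.\<close>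

lemma integral_gauss_kernel_double:
  assumes t: "t > 0"
  shows "(\<integral>x. gauss_kernel (2 * t) s a (Y x) * H x \<partial>N) =
    (\<integral>r. gauss t r * (\<integral>x. gauss_kernel t s (a - r) (Y x) * H x \<partial>N) \<partial>lborel)"
proof -
  interpret P: pair_sigma_finite lborel N ..
  have "integrable (lborel \<Otimes>\<^sub>M N)
      (\<lambda>(r, x). gauss t r * (gauss_kernel t s (a - r) (Y x) * H x))"
  proof (rule P.integrable_pairI)
    show "integrable lborel (\<lambda>r. gauss t r * (2 * gauss_const t * D * sq_sum))"
      using t by simp
    show "AE r in lborel. (\<integral>\<^sup>+ x. norm (case (r, x) of (r, x) \<Rightarrow>
        gauss t r * (gauss_kernel t s (a - r) (Y x) * H x)) \<partial>N) \<le>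
        ennreal (gauss t r * (2 * gauss_const t * D * sq_sum))"
    proof (rule AE_I2)
      fix r
      have "(\<integral>\<^sup>+ x. norm (case (r, x) of (r, x) \<Rightarrow>
          gauss t r * (gauss_kernel t s (a - r) (Y x) * H x)) \<partial>N) =
          ennreal (gauss t r) * (\<integral>\<^sup>+ x. norm (gauss_kernel t s (a - r) (Y x) * H x) \<partial>N)"
        by (subst nn_integral_cmult[symmetric], measurable)
          (auto simp: norm_mult ennreal_mult intro!: nn_integral_cong)
      also have "\<dots> \<le> ennreal (gauss t r) * ennreal (2 * gauss_const t * D * sq_sum)"
        by (intro mult_left_mono nn_integral_le[OF norm_gauss_kernel_le[OF t]]) auto
      also have "\<dots> = ennreal (gauss t r * (2 * gauss_const t * D * sq_sum))"
        by (simp add: ennreal_mult')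
      finally show "(\<integral>\<^sup>+ x. norm (case (r, x) of (r, x) \<Rightarrow>
          gauss t r * (gauss_kernel t s (a - r) (Y x) * H x)) \<partial>N) \<le>
          ennreal (gauss t r * (2 * gauss_const t * D * sq_sum))" .
    qed
  qed measurable
  from P.Fubini_integral[OF this]
  have "(\<integral>x. (\<integral>r. gauss t r * (gauss_kernel t s (a - r) (Y x) * H x) \<partial>lborel) \<partial>N) =
    (\<integral>r. gauss t r * (\<integral>x. gauss_kernel t s (a - r) (Y x) * H x \<partial>N) \<partial>lborel)"
    by simp
  moreover have "(\<integral>r. gauss t r * (gauss_kernel t s (a - r) (Y x) * H x) \<partial>lborel) =
      gauss_kernel (2 * t) s a (Y x) * H x" for x
  proof -
    have "(\<integral>r. gauss t r * (gauss_kernel t s (a - r) (Y x) * H x) \<partial>lborel) =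
      (\<integral>r. of_real (gauss t r * gauss t (a - Y x - r)) * (cis (s * Y x) * H x) \<partial>lborel)"
      by (rule Bochner_Integration.integral_cong) (auto simp: gauss_kernel_def algebra_simps)
    also have "\<dots> = of_real (gauss (2 * t) (a - Y x)) * (cis (s * Y x) * H x)"
      using gauss_conv[OF t, of "a - Y x"]
      by (simp only: integral_mult_left_zero integral_complex_of_real)
    finally show ?thesis by (simp add: gauss_kernel_def mult_ac)
  qed
  ultimately show ?thesis by simp
qed

lemma integral_gauss_kernel_measurable [measurable]:
  "(\<lambda>a. \<integral>x. gauss_kernel t s a (Y x) * H x \<partial>N) \<in> borel_measurable borel"
  by measurable

end

text \<open>Abstract form of sigma * rho = 0: the pieces of sigma are indexed by \<open>I\<close>,
  those of rho by \<open>L\<close>. The equation is tested in \<open>conv\<close> against functions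
  of quadratic decay, the class that is integrable for sigma and stable under translation.\<close>

locale wiener_system =
  fixes I :: "'i set" and N :: "'i \<Rightarrow> 'a measure" and Y :: "'i \<Rightarrow> 'a \<Rightarrow> real"
    and H :: "'i \<Rightarrow> 'a \<Rightarrow> complex" and D :: "'i \<Rightarrow> real"
    and L :: "'l set" and R :: "'l \<Rightarrow> 'b measure" and Z :: "'l \<Rightarrow> 'b \<Rightarrow> real"
    and W :: "'l \<Rightarrow> 'b \<Rightarrow> complex"
  assumes slab_bounded: "\<And>i. i \<in> I \<Longrightarrow> slab_bounded (N i) (Y i) (H i) (D i)"
    and Z [measurable]: "\<And>l. l \<in> L \<Longrightarrow> Z l \<in> borel_measurable (R l)"
    and W: "\<And>l. l \<in> L \<Longrightarrow> integrable (R l) (W l)"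
    and conv: "\<And>\<phi> C a. \<phi> \<in> borel_measurable borel \<Longrightarrow>
      (\<And>y. norm (\<phi> y :: complex) \<le> C / (1 + (y - a)\<^sup>2)) \<Longrightarrow>
      (\<Sum>l\<in>L. \<integral>z. (\<Sum>i\<in>I. \<integral>x. \<phi> (Y i x + Z l z) * H i x \<partial>N i) * W l z \<partial>R l) = 0"
    and nonzero: "\<And>s. (\<Sum>l\<in>L. \<integral>z. cis (s * Z l z) * W l z \<partial>R l) \<noteq> 0"
begin

text \<open>In the notation of the overview, M(t, s) is the supremum over \<open>a\<close> of the
  norm of \<open>u t s a\<close>, while \<open>F\<close> and \<open>eps\<close> below are the
  transform of rho and the error factor.\<close>

definition u :: "real \<Rightarrow> real \<Rightarrow> real \<Rightarrow> complex" where
  "u t s a = (\<Sum>i\<in>I. \<integral>x. gauss_kernel t s a (Y i x) * H i x \<partial>N i)"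

definition F :: "real \<Rightarrow> complex" where
  "F s = (\<Sum>l\<in>L. \<integral>z. cis (s * Z l z) * W l z \<partial>R l)"

definition eps :: "real \<Rightarrow> real" where
  "eps t = (\<Sum>l\<in>L. \<integral>z. min 2 ((Z l z)\<^sup>2 / t + 2 * \<bar>Z l z\<bar> / sqrt t) * norm (W l z) \<partial>R l)"

lemma W_measurable [measurable]: "l \<in> L \<Longrightarrow> W l \<in> borel_measurable (R l)"
  using W by auto

lemma u_measurable [measurable]: "u t s \<in> borel_measurable borel"
  unfolding u_def using slab_bounded.integral_gauss_kernel_measurable[OF slab_bounded]
  by (intro borel_measurable_sum)

lemma norm_u_le:
  assumes "t > 0"
  shows "norm (u t s a) \<le> (\<Sum>i\<in>I. 2 * gauss_const t * D i * sq_sum)"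
  unfolding u_def
  using assms by (intro sum_norm_le slab_bounded.norm_integral_gauss_kernel[OF slab_bounded])

lemma u_double:
  assumes t: "t > 0"
  shows "u (2 * t) s a = (\<integral>r. gauss t r * u t s (a - r) \<partial>lborel)"
proof -
  have "integrable lborel (\<lambda>r. gauss t r * (\<integral>x. gauss_kernel t s (a - r) (Y i x) * H i x \<partial>N i))"
    if i: "i \<in> I" for i
  proof (rule Bochner_Integration.integrable_bound)
    interpret slab_bounded "N i" "Y i" "H i" "D i" by (rule slab_bounded[OF i])
    show "integrable lborel (\<lambda>r. gauss t r * (2 * gauss_const t * D i * sq_sum))"
      using t by simp
    show "AE r in lborel. norm (gauss t r * (\<integral>x. gauss_kernel t s (a - r) (Y i x) * H i x \<partial>N i))
        \<le> norm (gauss t r * (2 * gauss_const t * D i * sq_sum))"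
      using norm_integral_gauss_kernel[OF t]
      by (intro AE_I2) (simp only: real_norm_def, rule order_trans[OF _ abs_ge_self],
        simp add: norm_mult mult_left_mono)
    show "(\<lambda>r. gauss t r * (\<integral>x. gauss_kernel t s (a - r) (Y i x) * H i x \<partial>N i))
      \<in> borel_measurable lborel"
      using integral_gauss_kernel_measurable[measurable] by measurable
  qed
  then show ?thesis
    unfolding u_def
    by (simp add: sum_distrib_left slab_bounded.integral_gauss_kernel_double[OF slab_bounded t])
qed

lemma integrable_cis_W: "l \<in> L \<Longrightarrow> integrable (R l) (\<lambda>z. cis (s * Z l z) * W l z)"
  by (rule Bochner_Integration.integrable_bound[OF W]) (auto simp: norm_mult cis_conv_exp)

lemma integrable_eps:
  "l \<in> L \<Longrightarrow> t > 0 \<Longrightarrow>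
    integrable (R l) (\<lambda>z. min 2 ((Z l z)\<^sup>2 / t + 2 * \<bar>Z l z\<bar> / sqrt t) * norm (W l z))"
  by (rule Bochner_Integration.integrable_bound[of _ "\<lambda>z. 2 * norm (W l z)"])
    (auto simp: abs_mult W intro!: mult_right_mono AE_I2)

text \<open>Test \<open>conv\<close> with a Gaussian kernel: translating its argument by w recentres
  it at a - w and releases the factor \<open>cis (s * w)\<close>, which becomes the integrand of
  \<open>F s\<close>.\<close>

lemma u_conv_zero:
  assumes t: "t > 0"
  shows "(\<Sum>l\<in>L. \<integral>z. u t s (a - Z l z) * (cis (s * Z l z) * W l z) \<partial>R l) = 0"
proof -
  have "(\<Sum>l\<in>L. \<integral>z. (\<Sum>i\<in>I. \<integral>x. gauss_kernel t s a (Y i x + Z l z) * H i x \<partial>N i) * W l z \<partial>R l) = 0"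
    by (rule conv[OF _ norm_gauss_kernel_le[OF t]]) measurable
  moreover have "(\<Sum>i\<in>I. \<integral>x. gauss_kernel t s a (Y i x + Z l z) * H i x \<partial>N i) =
      u t s (a - Z l z) * cis (s * Z l z)" for l z
  proof -
    have "gauss_kernel t s a (y + w) = cis (s * w) * gauss_kernel t s (a - w) y" for y w
      by (simp add: gauss_kernel_def cis_mult[symmetric] distrib_left diff_diff_eq add.commute[of y] mult_ac)
    then have shift: "gauss_kernel t s a (y + w) * h = cis (s * w) * (gauss_kernel t s (a - w) y * h)" for y w h
      by (metis mult.assoc)
    have "(\<integral>x. gauss_kernel t s a (Y i x + Z l z) * H i x \<partial>N i) =
        cis (s * Z l z) * (\<integral>x. gauss_kernel t s (a - Z l z) (Y i x) * H i x \<partial>N i)" for i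
      unfolding shift by (rule integral_mult_right_zero)
    then show ?thesis
      by (simp only: u_def sum_distrib_left[symmetric] mult.commute)
  qed
  ultimately show ?thesis by (simp only: mult.assoc)
qed

text \<open>By \<open>u_conv_zero\<close>, the average of v(a - z) against the modulated rho is 0,
  where v is the mean at 2t; subtracting it from F(s) v(a) leaves only differences v(a) - v(a - z).
  Of the variance 2t, one half is spent on smoothing, which makes these differences small, the other
  half on the function \<open>u t s\<close> bounded by \<open>M\<close>.\<close>

lemma contraction:
  assumes t: "t > 0" and M: "\<And>b. norm (u t s b) \<le> M"
  shows "norm (F s) * norm (u (2 * t) s a) \<le> M * eps t"
proof -
  let ?v = "u (2 * t) s"
  have shift: "norm (?v a - ?v (a - z)) \<le> M * min 2 (z\<^sup>2 / t + 2 * \<bar>z\<bar> / sqrt t)" for z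
    using gauss_mean_shift[OF u_measurable M t, where a = a and z = z] by (simp add: u_double[OF t])
  have int: "integrable (R l) (\<lambda>z. ?v (a - Z l z) * (cis (s * Z l z) * W l z))" if l: "l \<in> L" for l
  proof (rule Bochner_Integration.integrable_bound)
    let ?C = "\<Sum>i\<in>I. 2 * gauss_const (2 * t) * D i * sq_sum"
    show "integrable (R l) (\<lambda>z. ?C * norm (W l z))" using W[OF l] by simp
    show "AE z in R l. norm (?v (a - Z l z) * (cis (s * Z l z) * W l z)) \<le> norm (?C * norm (W l z))"
      using norm_u_le[of "2 * t"] t
      by (intro AE_I2) (simp only: real_norm_def, rule order_trans[OF _ abs_ge_self],
        simp add: norm_mult mult_right_mono)
    show "(\<lambda>z. ?v (a - Z l z) * (cis (s * Z l z) * W l z)) \<in> borel_measurable (R l)"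
      using l by (simp add: cis_conv_exp)
  qed
  have "F s * ?v a = (\<Sum>l\<in>L. \<integral>z. ?v a * (cis (s * Z l z) * W l z) \<partial>R l)"
    by (subst mult.commute) (simp only: F_def sum_distrib_left integral_mult_right_zero)
  also have "\<dots> = (\<Sum>l\<in>L. \<integral>z. ?v a * (cis (s * Z l z) * W l z) \<partial>R l)
      - (\<Sum>l\<in>L. \<integral>z. ?v (a - Z l z) * (cis (s * Z l z) * W l z) \<partial>R l)"
    using u_conv_zero[of "2 * t" s a] t by simp
  also have "\<dots> = (\<Sum>l\<in>L. \<integral>z. (?v a - ?v (a - Z l z)) * (cis (s * Z l z) * W l z) \<partial>R l)"
    using int integrable_cis_W by (simp add: sum_subtractf[symmetric] left_diff_distrib)
  finally have "norm (F s * ?v a) = norm \<dots>" by (rule arg_cong)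
  also have "\<dots> \<le> (\<Sum>l\<in>L. M * (\<integral>z. min 2 ((Z l z)\<^sup>2 / t + 2 * \<bar>Z l z\<bar> / sqrt t) * norm (W l z) \<partial>R l))"
  proof (rule sum_norm_le)
    fix l assume l: "l \<in> L"
    have "norm (\<integral>z. (?v a - ?v (a - Z l z)) * (cis (s * Z l z) * W l z) \<partial>R l) \<le>
      (\<integral>z. M * (min 2 ((Z l z)\<^sup>2 / t + 2 * \<bar>Z l z\<bar> / sqrt t) * norm (W l z)) \<partial>R l)"
    proof (rule norm_integral_le_integral)
      show "integrable (R l) (\<lambda>z. (?v a - ?v (a - Z l z)) * (cis (s * Z l z) * W l z))"
        using int[OF l] integrable_cis_W[OF l] by (simp add: left_diff_distrib)
      show "integrable (R l) (\<lambda>z. M * (min 2 ((Z l z)\<^sup>2 / t + 2 * \<bar>Z l z\<bar> / sqrt t) * norm (W l z)))"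
        using integrable_eps[OF l t] by simp
      show "norm ((?v a - ?v (a - Z l z)) * (cis (s * Z l z) * W l z)) \<le>
          M * (min 2 ((Z l z)\<^sup>2 / t + 2 * \<bar>Z l z\<bar> / sqrt t) * norm (W l z))" for z
      proof -
        have "norm ((?v a - ?v (a - Z l z)) * (cis (s * Z l z) * W l z)) =
            norm (?v a - ?v (a - Z l z)) * norm (W l z)"
          by (simp add: norm_mult)
        also have "\<dots> \<le> (M * min 2 ((Z l z)\<^sup>2 / t + 2 * \<bar>Z l z\<bar> / sqrt t)) * norm (W l z)"
          by (rule mult_right_mono[OF shift norm_ge_zero])
        finally show ?thesis by (simp only: mult.assoc)
      qed
    qed
    then show "norm (\<integral>z. (?v a - ?v (a - Z l z)) * (cis (s * Z l z) * W l z) \<partial>R l) \<le>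
      M * (\<integral>z. min 2 ((Z l z)\<^sup>2 / t + 2 * \<bar>Z l z\<bar> / sqrt t) * norm (W l z) \<partial>R l)"
      by simp
  qed
  finally show ?thesis by (simp only: norm_mult eps_def sum_distrib_left)
qed

text \<open>Dominated convergence: the \<open>min 2\<close> in \<open>eps\<close> gives the majorant
  \<open>2 * norm (W l z)\<close>, and the finitely massive weights need no control of large
  \<open>Z l z\<close>.\<close>

lemma eps_tendsto: "(\<lambda>k. eps (2 ^ k)) \<longlonglongrightarrow> 0"
proof -
  have "(\<lambda>k. \<integral>z. min 2 ((Z l z)\<^sup>2 / 2 ^ k + 2 * \<bar>Z l z\<bar> / sqrt (2 ^ k)) * norm (W l z) \<partial>R l) \<longlonglongrightarrow>
      (\<integral>z. 0 \<partial>R l)" if l: "l \<in> L" for l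
  proof (rule integral_dominated_convergence[where w = "\<lambda>z. 2 * norm (W l z)"])
    show "AE z in R l. (\<lambda>k. min 2 ((Z l z)\<^sup>2 / 2 ^ k + 2 * \<bar>Z l z\<bar> / sqrt (2 ^ k)) * norm (W l z)) \<longlonglongrightarrow> 0"
    proof (rule AE_I2)
      fix z
      have "(\<lambda>k. min 2 ((Z l z)\<^sup>2 / 2 ^ k + 2 * \<bar>Z l z\<bar> / sqrt 2 ^ k) * norm (W l z)) \<longlonglongrightarrow>
          min 2 (0 + 0) * norm (W l z)"
        by (intro tendsto_intros LIMSEQ_divide_realpow_zero) auto
      then show "(\<lambda>k. min 2 ((Z l z)\<^sup>2 / 2 ^ k + 2 * \<bar>Z l z\<bar> / sqrt (2 ^ k)) * norm (W l z)) \<longlonglongrightarrow> 0"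
        by (simp add: real_sqrt_power)
    qed
    show "AE z in R l. norm (min 2 ((Z l z)\<^sup>2 / 2 ^ k + 2 * \<bar>Z l z\<bar> / sqrt (2 ^ k)) * norm (W l z))
        \<le> 2 * norm (W l z)" for k
      by (auto simp: abs_mult intro!: mult_right_mono AE_I2)
  qed (use l W in auto)
  then have "(\<lambda>k. eps (2 ^ k)) \<longlonglongrightarrow> (\<Sum>l\<in>L. \<integral>z. 0 \<partial>R l)"
    unfolding eps_def by (intro tendsto_sum) auto
  then show ?thesis by simp
qed

lemma continuous_F: "isCont F s"
  unfolding continuous_at_sequentially
proof safe
  fix X assume X: "X \<longlonglongrightarrow> s"
  show "(F \<circ> X) \<longlonglongrightarrow> F s"
    unfolding comp_def F_def
  proof (rule tendsto_sum)
    fix l assume l: "l \<in> L"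
    show "(\<lambda>n. \<integral>z. cis (X n * Z l z) * W l z \<partial>R l) \<longlonglongrightarrow> (\<integral>z. cis (s * Z l z) * W l z \<partial>R l)"
      by (rule integral_dominated_convergence[where w = "\<lambda>z. norm (W l z)"])
        (use X l W integrable_cis_W in \<open>auto simp: norm_mult cis_conv_exp intro!: AE_I2 tendsto_intros\<close>)
  qed
qed

text \<open>The continuous function |F| has a positive minimum c on the compact interval of
  frequencies, so one threshold \<open>k0\<close> serves all of them; afterwards
  \<open>contraction\<close> is iterated.\<close>

lemma u_decay:
  obtains k0 C where "\<And>k s a. \<bar>s\<bar> \<le> B \<Longrightarrow> norm (u (2 ^ (k0 + k)) s a) \<le> C / 2 ^ k"
proof -
  obtain c where c: "c > 0" "\<And>s. \<bar>s\<bar> \<le> B \<Longrightarrow> norm (F s) \<ge> c"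
  proof (cases "B \<ge> 0")
    case True
    have "continuous_on {-B..B} (\<lambda>s. norm (F s))"
      using continuous_F by (intro continuous_intros continuous_at_imp_continuous_on) auto
    then obtain s0 where "s0 \<in> {-B..B}" "\<And>s. s \<in> {-B..B} \<Longrightarrow> norm (F s0) \<le> norm (F s)"
      using continuous_attains_inf[of "{-B..B}" "\<lambda>s. norm (F s)"] True by fastforce
    moreover have "norm (F s0) > 0" using nonzero[of s0] by (simp add: F_def)
    ultimately show ?thesis by (intro that[of "norm (F s0)"]) (auto simp: abs_le_iff)
  qed (use that[of 1] in force)
  have "\<forall>\<^sub>F k in sequentially. eps (2 ^ k) < c / 2"
    using eps_tendsto c(1) by (intro order_tendstoD) auto
  \<comment> \<open>The threshold c / 2 makes the contraction factor 1/2, safely below the 1 / sqrt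
    2 that \<open>wiener\<close> has to beat.\<close>
  then obtain k0 where k0: "\<And>k. k \<ge> k0 \<Longrightarrow> eps (2 ^ k) \<le> c / 2"
    unfolding eventually_sequentially by (meson less_imp_le)
  define C where "C = (\<Sum>i\<in>I. 2 * gauss_const (2 ^ k0) * D i * sq_sum)"
  have "norm (u (2 ^ (k0 + k)) s a) \<le> C / 2 ^ k" if s: "\<bar>s\<bar> \<le> B" for k s a
  proof (induction k arbitrary: a)
    case 0
    show ?case using norm_u_le[of "2 ^ k0" s a] by (simp add: C_def)
  next
    case (Suc k)
    have "0 \<le> C / 2 ^ k" using order_trans[OF norm_ge_zero Suc.IH[of 0]] .
    have "c * norm (u (2 * 2 ^ (k0 + k)) s a) \<le> norm (F s) * norm (u (2 * 2 ^ (k0 + k)) s a)"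
      using c(2)[OF s] by (intro mult_right_mono) auto
    also have "\<dots> \<le> C / 2 ^ k * eps (2 ^ (k0 + k))"
      by (intro contraction Suc.IH) auto
    also have "\<dots> \<le> C / 2 ^ k * (c / 2)"
      using \<open>0 \<le> C / 2 ^ k\<close> by (intro mult_left_mono k0) auto
    finally show ?case using c(1) by (simp add: field_simps)
  qed
  then show ?thesis by (rule that)
qed

text \<open>Regularise \<open>G\<close> by wide Gaussians and expand \<open>G\<close> in its
  frequencies. Fubini turns the regularised pairing into an average of \<open>u t s 0\<close> over
  |s| \<le> B with weight \<open>\<psi>\<close>, to which the uniform decay applies; removing the
  regularisation is dominated convergence.\<close>

lemma wiener:
  assumes \<psi>: "integrable lborel \<psi>" and supp: "\<And>s. \<bar>s\<bar> > B \<Longrightarrow> \<psi> s = 0"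
    and G: "\<And>y. G y = (\<integral>s. \<psi> s * cis (s * y) \<partial>lborel)"
    and bound: "\<And>y. norm (G y) \<le> C / (1 + y\<^sup>2)"
  shows "(\<Sum>i\<in>I. \<integral>x. G (Y i x) * H i x \<partial>N i) = 0"
proof -
  have [measurable]: "\<psi> \<in> borel_measurable borel" using \<psi> by auto
  have [measurable]: "G \<in> borel_measurable borel"
    unfolding G[abs_def] cis_conv_exp by measurable
  obtain k0 C' where decay: "\<And>k s a. \<bar>s\<bar> \<le> B \<Longrightarrow> norm (u (2 ^ (k0 + k)) s a) \<le> C' / 2 ^ k"
    using u_decay[of B] by blast
  define t :: "nat \<Rightarrow> real" where "t k = 2 ^ (k0 + k)" for k
  have t: "t k > 0" for k by (simp add: t_def)
  \<comment> \<open>The Gaussian without its normalisation, so that \<open>E k\<close> tends to 1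
    pointwise and stays below 1. The square root is the price for passing back to
    \<open>gauss\<close>.\<close>
  define E where "E k y = complex_of_real (sqrt (2 * pi * t k) * gauss (t k) y)" for k y
  have E: "E k y = of_real (exp (- (y\<^sup>2 / (2 * t k))))" for k y
    using t[of k] by (simp add: E_def gauss_eq)
  have [measurable]: "E k \<in> borel_measurable borel" for k
    unfolding E_def by measurable
  let ?S = "\<lambda>k. \<Sum>i\<in>I. \<integral>x. (G (Y i x) * E k (Y i x)) * H i x \<partial>N i"
  have "?S \<longlonglongrightarrow> (\<Sum>i\<in>I. \<integral>x. G (Y i x) * H i x \<partial>N i)"
  proof (rule tendsto_sum)
    fix i assume i: "i \<in> I"
    interpret slab_bounded "N i" "Y i" "H i" "D i" by (rule slab_bounded[OF i])
    have bound': "norm (G y) \<le> C / (1 + (y - 0)\<^sup>2)" for y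
      using bound by simp
    show "(\<lambda>k. \<integral>x. (G (Y i x) * E k (Y i x)) * H i x \<partial>N i) \<longlonglongrightarrow> (\<integral>x. G (Y i x) * H i x \<partial>N i)"
    proof (rule integral_dominated_convergence[where w = "\<lambda>x. norm (G (Y i x) * H i x)"])
      show "integrable (N i) (\<lambda>x. norm (G (Y i x) * H i x))"
        by (intro integrable_norm integrable_weight[OF _ bound']) measurable
      show "AE x in N i. (\<lambda>k. (G (Y i x) * E k (Y i x)) * H i x) \<longlonglongrightarrow> G (Y i x) * H i x"
      proof (rule AE_I2)
        fix x
        have "(\<lambda>k. (Y i x)\<^sup>2 / (2 * 2 ^ k0) / 2 ^ k) \<longlonglongrightarrow> 0"
          by (rule LIMSEQ_divide_realpow_zero) simp
        then have "(\<lambda>k. (Y i x)\<^sup>2 / (2 * t k)) \<longlonglongrightarrow> 0"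
          by (simp add: t_def power_add mult.assoc)
        then have "(\<lambda>k. (G (Y i x) * E k (Y i x)) * H i x) \<longlonglongrightarrow> (G (Y i x) * of_real (exp (- 0))) * H i x"
          unfolding E by (intro tendsto_intros)
        then show "(\<lambda>k. (G (Y i x) * E k (Y i x)) * H i x) \<longlonglongrightarrow> G (Y i x) * H i x"
          by simp
      qed
      show "AE x in N i. norm ((G (Y i x) * E k (Y i x)) * H i x) \<le> norm (G (Y i x) * H i x)" for k
        using t[of k] by (auto simp: E norm_mult intro!: AE_I2 mult_right_mono mult_left_le)
    qed measurable
  qed
  moreover have "?S \<longlonglongrightarrow> 0"
  proof (rule Lim_null_comparison)
    let ?P = "\<integral>s. norm (\<psi> s) \<partial>lborel"
    show "\<forall>\<^sub>F k in sequentially. norm (?S k) \<le> sqrt (2 * pi * t k) * (?P * (C' / 2 ^ k))"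
    proof (rule always_eventually, rule allI)
      fix k
      have swap: "(\<integral>x. (G (Y i x) * E k (Y i x)) * H i x \<partial>N i) = sqrt (2 * pi * t k) *
          (\<integral>s. \<psi> s * (\<integral>x. gauss_kernel (t k) s 0 (Y i x) * H i x \<partial>N i) \<partial>lborel)"
        and int: "integrable lborel (\<lambda>s. \<psi> s * (\<integral>x. gauss_kernel (t k) s 0 (Y i x) * H i x \<partial>N i))"
        if i: "i \<in> I" for i
      proof -
        interpret slab_bounded "N i" "Y i" "H i" "D i" by (rule slab_bounded[OF i])
        interpret P: pair_sigma_finite lborel "N i" ..
        have int2: "integrable (lborel \<Otimes>\<^sub>M N i)
            (\<lambda>(s, x). \<psi> s * (gauss_kernel (t k) s 0 (Y i x) * H i x))"
        proof (rule P.integrable_pairI)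
          show "integrable lborel (\<lambda>s. norm (\<psi> s) * (2 * gauss_const (t k) * D i * sq_sum))"
            using \<psi> by simp
          show "AE s in lborel. (\<integral>\<^sup>+ x. norm (case (s, x) of (s, x) \<Rightarrow>
              \<psi> s * (gauss_kernel (t k) s 0 (Y i x) * H i x)) \<partial>N i) \<le>
              ennreal (norm (\<psi> s) * (2 * gauss_const (t k) * D i * sq_sum))"
          proof (rule AE_I2)
            fix s
            have "(\<integral>\<^sup>+ x. norm (case (s, x) of (s, x) \<Rightarrow>
                \<psi> s * (gauss_kernel (t k) s 0 (Y i x) * H i x)) \<partial>N i) =
                ennreal (norm (\<psi> s)) * (\<integral>\<^sup>+ x. norm (gauss_kernel (t k) s 0 (Y i x) * H i x) \<partial>N i)"
              by (subst nn_integral_cmult[symmetric], measurable)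
                (auto simp: norm_mult ennreal_mult intro!: nn_integral_cong)
            also have "\<dots> \<le> ennreal (norm (\<psi> s)) * ennreal (2 * gauss_const (t k) * D i * sq_sum)"
              by (intro mult_left_mono nn_integral_le[OF norm_gauss_kernel_le[OF t]]) auto
            also have "\<dots> = ennreal (norm (\<psi> s) * (2 * gauss_const (t k) * D i * sq_sum))"
              by (simp add: ennreal_mult')
            finally show "(\<integral>\<^sup>+ x. norm (case (s, x) of (s, x) \<Rightarrow>
                \<psi> s * (gauss_kernel (t k) s 0 (Y i x) * H i x)) \<partial>N i) \<le>
                ennreal (norm (\<psi> s) * (2 * gauss_const (t k) * D i * sq_sum))" .
          qed
        qed (unfold gauss_kernel_def cis_conv_exp, measurable)
        from P.integrable_fst[OF int2]
        show "integrable lborel (\<lambda>s. \<psi> s * (\<integral>x. gauss_kernel (t k) s 0 (Y i x) * H i x \<partial>N i))"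
          by simp
        have "(\<integral>x. (\<integral>s. \<psi> s * (gauss_kernel (t k) s 0 (Y i x) * H i x) \<partial>lborel) \<partial>N i) =
          (\<integral>s. \<psi> s * (\<integral>x. gauss_kernel (t k) s 0 (Y i x) * H i x \<partial>N i) \<partial>lborel)"
          using P.Fubini_integral[OF int2] by simp
        moreover have "(G (Y i x) * E k (Y i x)) * H i x = sqrt (2 * pi * t k) *
            (\<integral>s. \<psi> s * (gauss_kernel (t k) s 0 (Y i x) * H i x) \<partial>lborel)" for x
        proof -
          have "(\<integral>s. \<psi> s * (gauss_kernel (t k) s 0 (Y i x) * H i x) \<partial>lborel) =
              (\<integral>s. (\<psi> s * cis (s * Y i x)) * (gauss (t k) (Y i x) * H i x) \<partial>lborel)"
            by (rule Bochner_Integration.integral_cong) (auto simp: gauss_kernel_def)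
          also have "\<dots> = G (Y i x) * (gauss (t k) (Y i x) * H i x)"
            unfolding G by (rule integral_mult_left_zero)
          finally show ?thesis by (simp add: E_def)
        qed
        ultimately show "(\<integral>x. (G (Y i x) * E k (Y i x)) * H i x \<partial>N i) = sqrt (2 * pi * t k) *
            (\<integral>s. \<psi> s * (\<integral>x. gauss_kernel (t k) s 0 (Y i x) * H i x \<partial>N i) \<partial>lborel)"
          by simp
      qed
      have S: "?S k = sqrt (2 * pi * t k) * (\<integral>s. \<psi> s * u (t k) s 0 \<partial>lborel)"
        using int by (simp add: swap u_def sum_distrib_left[symmetric] Bochner_Integration.integral_sum[symmetric])
      have "norm (\<integral>s. \<psi> s * u (t k) s 0 \<partial>lborel) \<le> (\<integral>s. norm (\<psi> s) * (C' / 2 ^ k) \<partial>lborel)"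
      proof (rule norm_integral_le_integral)
        show "integrable lborel (\<lambda>s. \<psi> s * u (t k) s 0)"
          using int by (simp add: u_def sum_distrib_left)
        show "integrable lborel (\<lambda>s. norm (\<psi> s) * (C' / 2 ^ k))"
          using \<psi> by simp
        show "norm (\<psi> s * u (t k) s 0) \<le> norm (\<psi> s) * (C' / 2 ^ k)" for s
        proof (cases "\<bar>s\<bar> \<le> B")
          case True
          then show ?thesis using decay[of s k 0] by (simp add: norm_mult t_def mult_left_mono del: times_divide_eq_right)
        qed (use supp[of s] in auto)
      qed
      then show "norm (?S k) \<le> sqrt (2 * pi * t k) * (?P * (C' / 2 ^ k))"
        unfolding S using t[of k] by (simp add: norm_mult mult_left_mono del: times_divide_eq_right)
    qed
    have "(\<lambda>k. sqrt (2 * pi * 2 ^ k0) * ?P * C' * (sqrt 2 / 2) ^ k) \<longlonglongrightarrow> sqrt (2 * pi * 2 ^ k0) * ?P * C' * 0"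
      by (intro tendsto_mult_left LIMSEQ_power_zero) (auto simp: sqrt2_less_2)
    then show "(\<lambda>k. sqrt (2 * pi * t k) * (?P * (C' / 2 ^ k))) \<longlonglongrightarrow> 0"
      by (simp add: t_def power_add real_sqrt_mult real_sqrt_power power_divide mult_ac)
  qed
  ultimately show ?thesis by (rule LIMSEQ_unique)
qed

end

section \<open>Fejer kernels\<close>

text \<open>Two closed halves, each ready for the fundamental theorem of calculus. They overlap at
  0, where the value is 2 instead of 1; \<open>tri\<close> is only ever integrated, so this point is
  harmless.\<close>

definition tri :: "real \<Rightarrow> real" where
  "tri s = indicator {-1..0} s * (1 + s) + indicator {0..1} s * (1 - s)"

text \<open>For nonzero y this is \<open>(sin (y / 2) / (y / 2))\<^sup>2\<close>, the Fourier
  transform of the triangle function, hence nonnegative, band-limited and of quadratic decay; the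
  value at 0 is the limit.\<close>

definition fejer :: "real \<Rightarrow> real" where
  "fejer y = (if y = 0 then 1 else 2 * (1 - cos y) / y\<^sup>2)"

lemma has_bochner_integral_cis_half:
  assumes y: "y \<noteq> 0"
  shows "has_bochner_integral lborel (\<lambda>s. indicator {0..1} s *\<^sub>R ((1 - s) *\<^sub>R cis (s * y)))
    ((1 + \<i> * y - cis y) / y\<^sup>2)"
    and "has_bochner_integral lborel (\<lambda>s. indicator {-1..0} s *\<^sub>R ((1 + s) *\<^sub>R cis (s * y)))
    ((1 - \<i> * y - cis (- y)) / y\<^sup>2)"
proof -
  have d: "((\<lambda>s. cis (s * y)) has_vector_derivative \<i> * y * cis (s * y)) (at s within A)" for s A
  proof -
    have "((\<lambda>z. exp (\<i> * (z * y))) has_field_derivative \<i> * y * exp (\<i> * (s * y))) (at (of_real s))"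
      by (auto intro!: derivative_eq_intros simp: mult_ac)
    from has_vector_derivative_real_field[OF this, of A] show ?thesis
      by (simp add: cis_conv_exp)
  qed
  \<comment> \<open>Antiderivative of \<open>(1 + c * s) * cis (s * y)\<close> from one integration
    by parts; c = -1 and c = 1 serve the right and the left half.\<close>
  let ?A = "\<lambda>c s. complex_of_real (1 + c * s) * cis (s * y) / (\<i> * y) + c * cis (s * y) / y\<^sup>2"
  have A: "(?A c has_vector_derivative (1 + c * s) *\<^sub>R cis (s * y)) (at s within X)" for c s :: real and X
    by (rule derivative_eq_intros d refl)+
      (use y in \<open>auto simp: field_simps scaleR_conv_of_real power2_eq_square\<close>)
  have "has_bochner_integral lborel (\<lambda>s. indicator {0..1} s *\<^sub>R ((1 + (-1) * s) *\<^sub>R cis (s * y)))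
      (?A (-1) 1 - ?A (-1) 0)"
    by (rule has_bochner_integral_FTC_Icc[OF _ A]) (auto simp: cis_conv_exp intro!: continuous_intros)
  moreover have "?A (-1) 1 - ?A (-1) 0 = (1 + \<i> * y - cis y) / y\<^sup>2"
    using y by (simp add: field_simps power2_eq_square)
  ultimately show "has_bochner_integral lborel (\<lambda>s. indicator {0..1} s *\<^sub>R ((1 - s) *\<^sub>R cis (s * y)))
    ((1 + \<i> * y - cis y) / y\<^sup>2)"
    by simp
  have "has_bochner_integral lborel (\<lambda>s. indicator {-1..0} s *\<^sub>R ((1 + 1 * s) *\<^sub>R cis (s * y)))
      (?A 1 0 - ?A 1 (-1))"
    by (rule has_bochner_integral_FTC_Icc[OF _ A]) (auto simp: cis_conv_exp intro!: continuous_intros)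
  moreover have "?A 1 0 - ?A 1 (-1) = (1 - \<i> * y - cis (- y)) / y\<^sup>2"
    using y by (simp add: field_simps power2_eq_square)
  ultimately show "has_bochner_integral lborel (\<lambda>s. indicator {-1..0} s *\<^sub>R ((1 + s) *\<^sub>R cis (s * y)))
    ((1 - \<i> * y - cis (- y)) / y\<^sup>2)"
    by simp
qed

lemma has_bochner_integral_tri: "has_bochner_integral lborel tri 1"
proof -
  have A: "((\<lambda>s. s + c * s\<^sup>2 / 2) has_vector_derivative 1 + c * s) (at s within X)" for c s :: real and X
    by (auto intro!: derivative_eq_intros simp: has_real_derivative_iff_has_vector_derivative[symmetric])
  have "has_bochner_integral lborel (\<lambda>s. indicator {-1..0} s *\<^sub>R (1 + 1 * s) + indicator {0..1} s *\<^sub>R (1 + (-1) * s))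
      (((0 + 1 * 0\<^sup>2 / 2) - (-1 + 1 * (-1)\<^sup>2 / 2)) + ((1 + (-1) * 1\<^sup>2 / 2) - (0 + (-1) * 0\<^sup>2 / 2) :: real))"
    by (intro has_bochner_integral_add has_bochner_integral_FTC_Icc A) (auto intro!: continuous_intros)
  then show ?thesis by (simp add: tri_def[abs_def])
qed

lemma has_bochner_integral_fejer:
  "has_bochner_integral lborel (\<lambda>s. tri s * cis (s * y)) (complex_of_real (fejer y))"
proof (cases "y = 0")
  case True
  then show ?thesis
    using has_bochner_integral_of_real[OF has_bochner_integral_tri] by (simp add: fejer_def cis_zero)
next
  case False
  have "(1 - \<i> * y - cis (- y)) / y\<^sup>2 + (1 + \<i> * y - cis y) / y\<^sup>2 = complex_of_real (fejer y)"
    using False by (simp add: fejer_def add_divide_distrib[symmetric] complex_eq_iff cis.code Re_divide Im_divide)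
  moreover have "indicator {-1..0} s *\<^sub>R ((1 + s) *\<^sub>R cis (s * y)) + indicator {0..1} s *\<^sub>R ((1 - s) *\<^sub>R cis (s * y))
      = tri s * cis (s * y)" for s
    by (simp add: tri_def scaleR_conv_of_real algebra_simps)
  ultimately show ?thesis
    using has_bochner_integral_add[OF has_bochner_integral_cis_half(2,1)[OF False]] by simp
qed

lemma fejer_nonneg: "fejer y \<ge> 0"
  by (simp add: fejer_def)

text \<open>From \<open>1 - cos y \<le> y\<^sup>2 / 2\<close> near 0 and
  \<open>1 - cos y \<le> 2\<close> far away; these would even give 5 in place of 8.\<close>

lemma fejer_le: "fejer y \<le> 8 / (1 + y\<^sup>2)"
proof -
  have "1 - cos y = 2 * (sin (y / 2))\<^sup>2"
    using cos_double_sin[of "y / 2"] by simp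
  also have "\<dots> \<le> 2 * (y / 2)\<^sup>2"
    using power_mono[OF abs_sin_x_le_abs_x[of "y / 2"], of 2] by (simp add: power_divide)
  finally have a: "4 * (1 - cos y) \<le> 2 * y\<^sup>2" by (simp add: power2_eq_square)
  have b: "1 - cos y \<le> 2" using cos_ge_minus_one[of y] by linarith
  have "2 * (1 - cos y) * (1 + y\<^sup>2) \<le> 8 * y\<^sup>2"
  proof -
    have "2 * (1 - cos y) * (1 + y\<^sup>2) = 2 * (1 - cos y) + 2 * ((1 - cos y) * y\<^sup>2)"
      by (simp add: algebra_simps)
    then show ?thesis
      using a mult_right_mono[OF b zero_le_power2[of y]] zero_le_power2[of y] by linarith
  qed
  then show ?thesis
    by (simp add: fejer_def divide_simps add_pos_nonneg)
qed

definition fejer2 :: "real \<Rightarrow> real" where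
  "fejer2 y = fejer y + fejer (y - 1)"

text \<open>The zeros of \<^const>\<open>fejer\<close> lie in \<open>2\<pi>\<int>\<close>, so two translates by \<open>1\<close> have no common zero.\<close>

lemma fejer2_pos: "fejer2 y > 0"
proof (rule ccontr)
  assume "\<not> fejer2 y > 0"
  then have "fejer y = 0" "fejer (y - 1) = 0"
    using fejer_nonneg[of y] fejer_nonneg[of "y - 1"] by (auto simp: fejer2_def)
  then have *: "cos y = 1" "cos (y - 1) = 1"
    by (auto simp: fejer_def split: if_splits)
  then have "sin y = 0" using sin_cos_squared_add[of y] by simp
  then have "cos 1 = (1::real)" using * by (simp add: cos_diff)
  then have "sin 1 = (0::real)" using sin_cos_squared_add[of "1::real"] by simp
  moreover have "sin 1 > (0::real)" using pi_gt3 by (intro sin_gt_zero) auto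
  ultimately show False by simp
qed

text \<open>40 = 8 + 4 * 8, as recentring from 1 to 0 by \<open>Peetre\<close> costs a factor
  4.\<close>

lemma fejer2_le: "fejer2 y \<le> 40 / (1 + y\<^sup>2)"
proof -
  have "8 / (1 + (y - 1)\<^sup>2) \<le> 32 / (1 + y\<^sup>2)"
    using Peetre[of y 1] by (simp add: divide_simps add_pos_nonneg)
  then show ?thesis
    using fejer_le[of y] fejer_le[of "y - 1"] by (simp add: fejer2_def)
qed

lemma fejer_measurable [measurable]: "fejer \<in> borel_measurable borel"
  unfolding fejer_def[abs_def] by measurable

lemma fejer2_measurable [measurable]: "fejer2 \<in> borel_measurable borel"
  unfolding fejer2_def[abs_def] by measurable

lemma (in wiener_system) sum_integral_fejer2_eq_0:
  "(\<Sum>i\<in>I. \<integral>x. complex_of_real (fejer2 (Y i x)) * H i x \<partial>N i) = 0"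
proof (rule wiener)
  \<comment> \<open>Translating \<open>fejer\<close> by 1 multiplies its transform by
    \<open>cis (- s)\<close>, so the support remains in [-1, 1].\<close>
  have eq: "tri s * (1 + cis (- s)) * cis (s * y) = tri s * cis (s * y) + tri s * cis (s * (y - 1))" for s y
    by (simp add: algebra_simps cis_mult)
  have "has_bochner_integral lborel (\<lambda>s. tri s * (1 + cis (- s)) * cis (s * y)) (complex_of_real (fejer2 y))" for y
    unfolding eq using has_bochner_integral_add[OF has_bochner_integral_fejer has_bochner_integral_fejer]
    by (simp add: fejer2_def)
  note * = this
  show "integrable lborel (\<lambda>s. tri s * (1 + cis (- s)))"
    using *[of 0] by (simp add: has_bochner_integral_iff cis_zero)
  show "complex_of_real (fejer2 y) = (\<integral>s. tri s * (1 + cis (- s)) * cis (s * y) \<partial>lborel)" for y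
    using *[of y] by (simp add: has_bochner_integral_iff)
  show "tri s * (1 + cis (- s)) = 0" if "\<bar>s\<bar> > 1" for s
    using that by (auto simp: tri_def indicator_def)
  show "norm (complex_of_real (fejer2 y)) \<le> 40 / (1 + y\<^sup>2)" for y
    using fejer2_le[of y] fejer2_pos[of y] by simp
qed

section \<open>Fourier uniqueness\<close>

text \<open>Fourier inversion is used for this single function only, where it amounts to the
  characteristic function of the standard normal law.\<close>

lemma gauss_eq_integral_cis:
  "complex_of_real (gauss 1 w) = (\<integral>s. gauss 1 s * cis (s * w) \<partial>lborel) / sqrt (2 * pi)"
proof -
  have "(\<integral>s. gauss 1 s * cis (s * w) \<partial>lborel) = (\<integral>s. gauss 1 s *\<^sub>R iexp (w * s) \<partial>lborel)"
    by (rule Bochner_Integration.integral_cong) (auto simp: cis_conv_exp scaleR_conv_of_real mult_ac)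
  also have "\<dots> = char std_normal_distribution w"
    unfolding char_def gauss_def by (subst integral_density) (auto intro: AE_I2)
  finally show ?thesis
    by (simp add: char_std_normal_distribution gauss_eq)
qed

text \<open>The point is the right-hand side: \<open>H\<close> and \<open>Y\<close> occur there only
  through the Fourier transform of the weight.\<close>

lemma (in sigma_finite_measure) integral_gauss_transform:
  fixes H :: "'a \<Rightarrow> complex"
  assumes [measurable]: "Y \<in> borel_measurable M" and H: "integrable M H"
  shows "(\<integral>x. gauss 1 (p * Y x + q) * H x \<partial>M) =
    (\<integral>s. gauss 1 s * cis (s * q) * (\<integral>x. cis ((s * p) * Y x) * H x \<partial>M) \<partial>lborel) / sqrt (2 * pi)"
proof -
  interpret P: pair_sigma_finite lborel M ..
  have [measurable]: "H \<in> borel_measurable M" using H by auto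
  have "integrable (lborel \<Otimes>\<^sub>M M) (\<lambda>(s, x). gauss 1 s * cis (s * (p * Y x + q)) * H x)"
  proof (rule P.integrable_pairI)
    show "integrable lborel (\<lambda>s. gauss 1 s * (\<integral>x. norm (H x) \<partial>M))" by simp
    show "AE s in lborel. (\<integral>\<^sup>+ x. norm (case (s, x) of (s, x) \<Rightarrow>
        gauss 1 s * cis (s * (p * Y x + q)) * H x) \<partial>M) \<le> ennreal (gauss 1 s * (\<integral>x. norm (H x) \<partial>M))"
      using H by (intro AE_I2) (simp add: norm_mult ennreal_mult nn_integral_cmult
        nn_integral_eq_integral[symmetric])
  qed (unfold cis_conv_exp, measurable)
  from P.Fubini_integral[OF this]
  have "(\<integral>x. (\<integral>s. gauss 1 s * cis (s * (p * Y x + q)) * H x \<partial>lborel) \<partial>M) =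
    (\<integral>s. (\<integral>x. gauss 1 s * cis (s * (p * Y x + q)) * H x \<partial>M) \<partial>lborel)"
    by simp
  also have "(\<integral>s. (\<integral>x. gauss 1 s * cis (s * (p * Y x + q)) * H x \<partial>M) \<partial>lborel) =
    (\<integral>s. gauss 1 s * cis (s * q) * (\<integral>x. cis ((s * p) * Y x) * H x \<partial>M) \<partial>lborel)"
  proof (rule Bochner_Integration.integral_cong[OF refl])
    fix s
    have "gauss 1 s * cis (s * (p * Y x + q)) * H x =
        gauss 1 s * cis (s * q) * (cis ((s * p) * Y x) * H x)" for x
      by (simp only: distrib_left cis_mult[symmetric] mult_ac)
    then show "(\<integral>x. gauss 1 s * cis (s * (p * Y x + q)) * H x \<partial>M) =
        gauss 1 s * cis (s * q) * (\<integral>x. cis ((s * p) * Y x) * H x \<partial>M)"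
      by (simp only: integral_mult_right_zero)
  qed
  finally have *: "(\<integral>x. (\<integral>s. gauss 1 s * cis (s * (p * Y x + q)) * H x \<partial>lborel) \<partial>M) =
    (\<integral>s. gauss 1 s * cis (s * q) * (\<integral>x. cis ((s * p) * Y x) * H x \<partial>M) \<partial>lborel)" .
  have "gauss 1 (p * Y x + q) * H x =
      (\<integral>s. gauss 1 s * cis (s * (p * Y x + q)) * H x \<partial>lborel) / sqrt (2 * pi)" for x
    unfolding gauss_eq_integral_cis[of "p * Y x + q"] by simp
  then show ?thesis
    unfolding *[symmetric] by simp
qed

text \<open>Moves the smoothing at scale 1 / p from the test function \<open>g\<close> to the weight
  \<open>H\<close>, by substituting a = Y x + r / p and exchanging the integrals. The inner integral
  is then of the kind just expressed by the transform.\<close>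

lemma (in sigma_finite_measure) integral_gauss_mean:
  fixes H :: "'a \<Rightarrow> complex"
  assumes [measurable]: "Y \<in> borel_measurable M" and H: "integrable M H"
    and [measurable]: "g \<in> borel_measurable borel" and g: "\<And>y. \<bar>g y\<bar> \<le> (1::real)" and p: "p > 0"
  shows "(\<integral>x. (\<integral>r. gauss 1 r * g (Y x + r / p) \<partial>lborel) * H x \<partial>M) =
    (\<integral>a. g a * p * (\<integral>x. gauss 1 (- p * Y x + p * a) * H x \<partial>M) \<partial>lborel)"
proof -
  interpret P: pair_sigma_finite M lborel ..
  have [measurable]: "H \<in> borel_measurable M" using H by auto
  have mass: "(\<integral>a. p * gauss 1 (- p * y + p * a) \<partial>lborel) = 1"
    "integrable lborel (\<lambda>a. p * gauss 1 (- p * y + p * a))" for y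
    using lborel_integral_real_affine[of p "gauss 1" "- p * y"]
      lborel_integrable_real_affine[of "gauss 1" p "- p * y"] p by auto
  have "integrable (M \<Otimes>\<^sub>M lborel) (\<lambda>(x, a). (p * gauss 1 (- p * Y x + p * a)) * g a * H x)"
  proof (rule P.integrable_pairI)
    show "integrable M (\<lambda>x. norm (H x))" using H by simp
    show "AE x in M. (\<integral>\<^sup>+ a. norm (case (x, a) of (x, a) \<Rightarrow>
        (p * gauss 1 (- p * Y x + p * a)) * g a * H x) \<partial>lborel) \<le> ennreal (norm (H x))"
    proof (rule AE_I2)
      fix x
      have "(\<integral>\<^sup>+ a. norm (case (x, a) of (x, a) \<Rightarrow>
          (p * gauss 1 (- p * Y x + p * a)) * g a * H x) \<partial>lborel) \<le>
          (\<integral>\<^sup>+ a. ennreal (norm (H x)) * ennreal (p * gauss 1 (- p * Y x + p * a)) \<partial>lborel)"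
      proof (rule nn_integral_mono)
        fix a
        have "norm ((p * gauss 1 (- p * Y x + p * a)) * g a * H x) =
            norm (H x) * (p * gauss 1 (- p * Y x + p * a)) * \<bar>g a\<bar>"
          using p by (simp add: norm_mult)
        also have "\<dots> \<le> norm (H x) * (p * gauss 1 (- p * Y x + p * a)) * 1"
          using p g by (intro mult_left_mono) auto
        finally show "ennreal (norm (case (x, a) of (x, a) \<Rightarrow>
            (p * gauss 1 (- p * Y x + p * a)) * g a * H x)) \<le>
            ennreal (norm (H x)) * ennreal (p * gauss 1 (- p * Y x + p * a))"
          using p by (simp add: ennreal_mult[symmetric] ennreal_leI)
      qed
      also have "\<dots> = ennreal (norm (H x))"
        using p mass[of "Y x"] by (simp add: nn_integral_cmult nn_integral_eq_integral)
      finally show "(\<integral>\<^sup>+ a. norm (case (x, a) of (x, a) \<Rightarrow>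
          (p * gauss 1 (- p * Y x + p * a)) * g a * H x) \<partial>lborel) \<le> ennreal (norm (H x))" .
    qed
  qed measurable
  from P.Fubini_integral[OF this]
  have "(\<integral>x. (\<integral>a. (p * gauss 1 (- p * Y x + p * a)) * g a * H x \<partial>lborel) \<partial>M) =
    (\<integral>a. (\<integral>x. (p * gauss 1 (- p * Y x + p * a)) * g a * H x \<partial>M) \<partial>lborel)"
    by simp
  also have "\<dots> = (\<integral>a. g a * p * (\<integral>x. gauss 1 (- p * Y x + p * a) * H x \<partial>M) \<partial>lborel)"
  proof (rule Bochner_Integration.integral_cong[OF refl])
    fix a
    have "(p * gauss 1 (- p * Y x + p * a)) * g a * H x =
        (g a * p) * (gauss 1 (- p * Y x + p * a) * H x)" for x
      by simp
    then show "(\<integral>x. (p * gauss 1 (- p * Y x + p * a)) * g a * H x \<partial>M) =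
        g a * p * (\<integral>x. gauss 1 (- p * Y x + p * a) * H x \<partial>M)"
      by (simp only: integral_mult_right_zero)
  qed
  finally have *: "(\<integral>x. (\<integral>a. (p * gauss 1 (- p * Y x + p * a)) * g a * H x \<partial>lborel) \<partial>M) =
    (\<integral>a. g a * p * (\<integral>x. gauss 1 (- p * Y x + p * a) * H x \<partial>M) \<partial>lborel)" .
  have eq: "(\<integral>a. (p * gauss 1 (- p * Y x + p * a)) * g a * H x \<partial>lborel) =
      (\<integral>r. gauss 1 r * g (Y x + r / p) \<partial>lborel) * H x" for x
  proof -
    have "(\<integral>r. gauss 1 r * g (Y x + r / p) \<partial>lborel) =
        (\<integral>a. (p * gauss 1 (- p * Y x + p * a)) * g a \<partial>lborel)"
    proof -
      have "Y x + (- p * Y x + p * a) / p = a" for a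
        using p by (simp add: field_simps)
      then show ?thesis
        using lborel_integral_real_affine[of p "\<lambda>r. gauss 1 r * g (Y x + r / p)" "- p * Y x"] p
        by (simp add: mult.assoc)
    qed
    then show ?thesis
      by (simp only: integral_mult_left_zero of_real_mult[symmetric] integral_complex_of_real)
  qed
  show ?thesis
    using *[unfolded eq] by simp
qed

lemma (in sigma_finite_measure) integral_gauss_mean_transform:
  fixes H :: "'a \<Rightarrow> complex"
  assumes "Y \<in> borel_measurable M" "integrable M H" "g \<in> borel_measurable borel"
    "\<And>y. \<bar>g y\<bar> \<le> (1::real)" "p > 0"
  shows "(\<integral>x. of_real (\<integral>r. gauss 1 r * g (Y x + r / p) \<partial>lborel) * H x \<partial>M) =
    (\<integral>a. g a * p * ((\<integral>s. gauss 1 s * cis (s * (p * a)) *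
      (\<integral>x. cis ((s * - p) * Y x) * H x \<partial>M) \<partial>lborel) / sqrt (2 * pi)) \<partial>lborel)"
  unfolding integral_gauss_mean[OF assms] integral_gauss_transform[OF assms(1,2)] ..

text \<open>\<open>H1\<close> and \<open>H2\<close> are complex, so their images are no probability
  distributions; the proof is by mollification. Smoothed test functions are determined by the
  transform, continuous bounded ones follow as the scale shrinks, half-lines by continuous
  cut-offs.\<close>

lemma Fourier_unique:
  fixes H1 :: "'a \<Rightarrow> complex" and H2 :: "'b \<Rightarrow> complex"
  assumes "sigma_finite_measure M1" "sigma_finite_measure M2"
    and [measurable]: "Y1 \<in> borel_measurable M1" "Y2 \<in> borel_measurable M2"
    and H1: "integrable M1 H1" and H2: "integrable M2 H2"
    and eq: "\<And>s. (\<integral>x. cis (s * Y1 x) * H1 x \<partial>M1) = (\<integral>x. cis (s * Y2 x) * H2 x \<partial>M2)"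
  shows "(\<integral>x. indicator {..b} (Y1 x) * H1 x \<partial>M1) = (\<integral>x. indicator {..b} (Y2 x) * H2 x \<partial>M2)"
proof -
  have lim: "(\<lambda>n. \<integral>x. of_real (f n (Y x)) * H x \<partial>M) \<longlonglongrightarrow> (\<integral>x. of_real (f' (Y x)) * H x \<partial>M)"
    if [measurable]: "Y \<in> borel_measurable M" "\<And>n. f n \<in> borel_measurable borel" "f' \<in> borel_measurable borel"
      and H: "integrable M H" and f: "\<And>n y. \<bar>f n y\<bar> \<le> 1" "\<And>y. (\<lambda>n. f n y) \<longlonglongrightarrow> f' y"
    for f :: "nat \<Rightarrow> real \<Rightarrow> real" and f' Y M and H :: "'c \<Rightarrow> complex"
  proof (rule integral_dominated_convergence[where w = "\<lambda>x. norm (H x)"])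
    have [measurable]: "H \<in> borel_measurable M" using H by auto
    show "(\<lambda>x. of_real (f n (Y x)) * H x) \<in> borel_measurable M" for n by measurable
    show "(\<lambda>x. of_real (f' (Y x)) * H x) \<in> borel_measurable M" by measurable
    show "AE x in M. (\<lambda>n. of_real (f n (Y x)) * H x) \<longlonglongrightarrow> of_real (f' (Y x)) * H x"
      by (intro AE_I2 tendsto_intros f(2))
    show "AE x in M. norm (of_real (f n (Y x)) * H x) \<le> norm (H x)" for n
      using mult_right_mono[OF f(1) norm_ge_zero] by (intro AE_I2) (simp add: norm_mult)
  qed (use H in simp)
  have cont: "(\<integral>x. of_real (g (Y1 x)) * H1 x \<partial>M1) = (\<integral>x. of_real (g (Y2 x)) * H2 x \<partial>M2)"
    if g: "continuous_on UNIV g" "\<And>y. \<bar>g y\<bar> \<le> 1" for g :: "real \<Rightarrow> real"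
  proof -
    have [measurable]: "g \<in> borel_measurable borel"
      using g(1) by (rule borel_measurable_continuous_onI)
    define f where "f n y = (\<integral>r. gauss 1 r * g (y + r / Suc n) \<partial>lborel)" for n :: nat and y
    have [measurable]: "f n \<in> borel_measurable borel" for n unfolding f_def by measurable
    have le: "norm (gauss 1 r * g y) \<le> gauss 1 r" for r y
      using mult_left_mono[OF g(2) gauss_nonneg] by (simp add: abs_mult)
    have f1: "\<bar>f n y\<bar> \<le> 1" for n y
    proof -
      have "norm (f n y) \<le> (\<integral>r. gauss 1 r \<partial>lborel)"
        unfolding f_def
      proof (rule norm_integral_le_integral)
        show "norm (gauss 1 r * g (y + r / Suc n)) \<le> gauss 1 r" for r
          by (rule le)
        show "integrable lborel (\<lambda>r. gauss 1 r * g (y + r / Suc n))"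
          by (rule Bochner_Integration.integrable_bound[of lborel "gauss 1"])
            (simp, measurable, use le in \<open>simp add: AE_I2\<close>)
      qed simp
      then show ?thesis by simp
    qed
    have f2: "(\<lambda>n. f n y) \<longlonglongrightarrow> g y" for y
    proof -
      have "(\<lambda>n. f n y) \<longlonglongrightarrow> (\<integral>r. gauss 1 r * g y \<partial>lborel)"
        unfolding f_def
      proof (rule integral_dominated_convergence[where w = "gauss 1"])
        have "(\<lambda>n. g (y + r / Suc n)) \<longlonglongrightarrow> g y" for r
        proof -
          have "(\<lambda>n. y + r / Suc n) \<longlonglongrightarrow> y + 0"
            by (intro tendsto_intros LIMSEQ_Suc[OF lim_const_over_n])
          then show ?thesis
            using isCont_tendsto_compose[of y g] g(1) by (simp add: continuous_on_eq_continuous_at)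
        qed
        then show "AE r in lborel. (\<lambda>n. gauss 1 r * g (y + r / Suc n)) \<longlonglongrightarrow> gauss 1 r * g y"
          by (intro AE_I2 tendsto_mult_left)
        show "AE r in lborel. norm (gauss 1 r * g (y + r / Suc n)) \<le> gauss 1 r" for n
          by (intro AE_I2 le)
      qed simp_all
      then show ?thesis by simp
    qed
    have "(\<integral>x. of_real (f n (Y1 x)) * H1 x \<partial>M1) = (\<integral>x. of_real (f n (Y2 x)) * H2 x \<partial>M2)" for n
    proof -
      have p: "real (Suc n) > 0" by simp
      show ?thesis
        unfolding f_def
          sigma_finite_measure.integral_gauss_mean_transform[OF assms(1,3) H1 \<open>g \<in> borel_measurable borel\<close> g(2) p]
          sigma_finite_measure.integral_gauss_mean_transform[OF assms(2,4) H2 \<open>g \<in> borel_measurable borel\<close> g(2) p]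
          eq ..
    qed
    moreover have "(\<lambda>n. \<integral>x. of_real (f n (Y1 x)) * H1 x \<partial>M1) \<longlonglongrightarrow> (\<integral>x. of_real (g (Y1 x)) * H1 x \<partial>M1)"
      by (rule lim[OF _ _ _ H1 f1 f2]) measurable
    moreover have "(\<lambda>n. \<integral>x. of_real (f n (Y2 x)) * H2 x \<partial>M2) \<longlonglongrightarrow> (\<integral>x. of_real (g (Y2 x)) * H2 x \<partial>M2)"
      by (rule lim[OF _ _ _ H2 f1 f2]) measurable
    ultimately show ?thesis by (simp add: LIMSEQ_unique)
  qed
  \<comment> \<open>Equal to 1 up to b, then descending linearly to 0 at b + 1 / (n + 1); the limit
    is the indicator of the closed half-line.\<close>
  define c where "c n = cts_step b (b + 1 / Suc n)" for n
  have c: "continuous_on UNIV (c n)" "\<bar>c n y\<bar> \<le> 1" for n y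
    unfolding c_def
    by (intro uniformly_continuous_imp_continuous cts_step_uniformly_continuous, simp)
      (auto simp: cts_step_def divide_simps)
  have [measurable]: "c n \<in> borel_measurable borel" for n
    by (rule borel_measurable_continuous_onI[OF c(1)])
  have c2: "(\<lambda>n. c n y) \<longlonglongrightarrow> indicator {..b} y" for y
  proof (cases "y \<le> b")
    case False
    have "(\<lambda>n. b + 1 / Suc n) \<longlonglongrightarrow> b + 0"
      by (intro tendsto_intros LIMSEQ_Suc[OF lim_const_over_n])
    then have "\<forall>\<^sub>F n in sequentially. b + 1 / Suc n < y"
      using False by (intro order_tendstoD) auto
    then have "\<forall>\<^sub>F n in sequentially. c n y = indicator {..b} y"
      by eventually_elim (use False in \<open>auto simp: c_def cts_step_def\<close>)
    then show ?thesis by (rule tendsto_eventually)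
  qed (auto simp: c_def cts_step_def)
  have "(\<lambda>n. \<integral>x. of_real (c n (Y1 x)) * H1 x \<partial>M1) \<longlonglongrightarrow> (\<integral>x. of_real (indicator {..b} (Y1 x)) * H1 x \<partial>M1)"
    by (rule lim[OF _ _ _ H1 c(2) c2]) measurable
  moreover have "(\<lambda>n. \<integral>x. of_real (c n (Y2 x)) * H2 x \<partial>M2) \<longlonglongrightarrow> (\<integral>x. of_real (indicator {..b} (Y2 x)) * H2 x \<partial>M2)"
    by (rule lim[OF _ _ _ H2 c(2) c2]) measurable
  ultimately show ?thesis
    using cont[OF c] by (simp add: LIMSEQ_unique of_real_indicator)
qed

section \<open>Signs and multiplicative convolution\<close>

lemma signsD: "v \<in> signs \<Longrightarrow> v $ k = -1 \<or> v $ k = 1"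
  by (simp add: signs_def)

lemma signs_mult:
  assumes "v \<in> signs" "w \<in> signs" shows "v * w \<in> signs"
proof -
  have "v $ k * w $ k \<in> {-1, 1}" for k
    using signsD[OF assms(1), of k] signsD[OF assms(2), of k] by auto
  then show ?thesis by (simp add: signs_def times_vec_def)
qed

lemma signs_square:
  assumes "v \<in> signs" shows "v * v = 1"
proof -
  have "v $ k * v $ k = 1" for k
    using signsD[OF assms, of k] by auto
  then show ?thesis by (simp add: vec_eq_iff times_vec_def one_vec_def)
qed

lemma bij_betw_signs_mult:
  assumes w: "w \<in> signs"
  shows "bij_betw (\<lambda>v. v * w) signs signs"
  by (rule bij_betwI[where g = "\<lambda>v. v * w"])
    (use signs_mult w signs_square[OF w] in \<open>auto simp: mult.assoc\<close>)

text \<open>The characters of the sign group; \<open>T\<close> is the set of indices k with m_k = 1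
  in the non-vanishing hypothesis.\<close>

definition sign_char :: "'d set \<Rightarrow> real ^ 'd \<Rightarrow> real" where
  "sign_char T v = (\<Prod>k\<in>T. v $ k)"

lemma sign_char_mult: "sign_char T (v * w) = sign_char T v * sign_char T w"
  by (simp add: sign_char_def times_vec_def prod.distrib)

lemma abs_sign_char:
  assumes "v \<in> signs" shows "\<bar>sign_char T v\<bar> = 1"
proof -
  have "\<bar>v $ k\<bar> = 1" for k
    using signsD[OF assms, of k] by auto
  then show ?thesis by (simp add: sign_char_def abs_prod)
qed

text \<open>Orthogonality of characters: summing over all \<open>T\<close> factorises into the
  product of the \<open>w $ k * v $ k + 1\<close>, in which a factor vanishes as soon as v and w
  differ in a coordinate.\<close>

lemma sign_char_inversion:
  fixes b :: "real ^ 'd::finite \<Rightarrow> complex"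
  assumes zero: "\<And>T. (\<Sum>v\<in>signs. sign_char T v * b v) = 0" and w: "w \<in> signs"
  shows "b w = 0"
proof -
  have orth: "(\<Sum>T\<in>Pow UNIV. sign_char T w * sign_char T v) = (if v = w then 2 ^ CARD('d) else 0)"
    if v: "v \<in> signs" for v
  proof -
    have "(\<Sum>T\<in>Pow UNIV. sign_char T w * sign_char T v) = (\<Prod>k\<in>UNIV. w $ k * v $ k + 1)"
      by (simp add: prod_add sign_char_def prod.distrib)
    also have "\<dots> = (if v = w then 2 ^ CARD('d) else 0)"
    proof (cases "v = w")
      case True
      have "w $ k * w $ k = 1" for k using signsD[OF w, of k] by auto
      then show ?thesis using True by simp
    next
      case False
      then obtain k where "v $ k \<noteq> w $ k" by (auto simp: vec_eq_iff)
      then have "w $ k * v $ k + 1 = 0"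
        using signsD[OF v, of k] signsD[OF w, of k] by auto
      then show ?thesis using False by (auto intro!: prod_zero)
    qed
    finally show ?thesis .
  qed
  have "0 = (\<Sum>T\<in>Pow UNIV. sign_char T w * (\<Sum>v\<in>signs. sign_char T v * b v))"
    by (simp add: zero)
  also have "\<dots> = (\<Sum>v\<in>signs. (\<Sum>T\<in>Pow UNIV. sign_char T w * sign_char T v) * b v)"
    by (simp add: sum_distrib_left sum_distrib_right mult.assoc) (rule sum.swap)
  also have "\<dots> = (\<Sum>v\<in>signs. if v = w then 2 ^ CARD('d) * b w else 0)"
    by (rule sum.cong[OF refl], subst orth, assumption, simp)
  also have "\<dots> = 2 ^ CARD('d) * b w"
    using w by (simp add: sum.delta[OF finite_signs])
  finally show ?thesis by simp
qed

text \<open>The system equates finite sums of measures set by set. This passes to integrals without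
  forming the sum measures, by induction over measurable functions.\<close>

lemma nn_integral_sum_measure_cong:
  fixes M M' :: "'i \<Rightarrow> 'a measure"
  assumes sets: "\<And>i. i \<in> I \<Longrightarrow> sets (M i) = sets B" "\<And>i. i \<in> I \<Longrightarrow> sets (M' i) = sets B"
    and eq: "\<And>A. A \<in> sets B \<Longrightarrow> (\<Sum>i\<in>I. emeasure (M i) A) = (\<Sum>i\<in>I. emeasure (M' i) A)"
    and f: "f \<in> borel_measurable B"
  shows "(\<Sum>i\<in>I. \<integral>\<^sup>+ x. f x \<partial>M i) = (\<Sum>i\<in>I. \<integral>\<^sup>+ x. f x \<partial>M' i)"
  using f
proof (induction rule: borel_measurable_induct)
  case (cong f g)
  have "(\<integral>\<^sup>+ x. f x \<partial>M i) = (\<integral>\<^sup>+ x. g x \<partial>M i)" "(\<integral>\<^sup>+ x. f x \<partial>M' i) = (\<integral>\<^sup>+ x. g x \<partial>M' i)" if "i \<in> I" for i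
    using cong(3) sets_eq_imp_space_eq[OF sets(1)[OF that]] sets_eq_imp_space_eq[OF sets(2)[OF that]]
    by (auto intro!: nn_integral_cong)
  then show ?case using cong by simp
next
  case (set A)
  then show ?case using eq[of A] sets by simp
next
  case (mult u c)
  then have "u \<in> borel_measurable (M i)" "u \<in> borel_measurable (M' i)" if "i \<in> I" for i
    using that sets by (auto cong: measurable_cong_sets)
  then show ?case
    using mult by (simp add: nn_integral_cmult sum_distrib_left[symmetric])
next
  case (add u v)
  then have "u \<in> borel_measurable (M i)" "u \<in> borel_measurable (M' i)"
    "v \<in> borel_measurable (M i)" "v \<in> borel_measurable (M' i)" if "i \<in> I" for i
    using that sets by (auto cong: measurable_cong_sets)
  then show ?case
    using add by (simp add: nn_integral_add sum.distrib)
next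
  case (seq U)
  then have [measurable]: "U n \<in> borel_measurable (M i)" "U n \<in> borel_measurable (M' i)" if "i \<in> I" for i n
    using that sets by (auto cong: measurable_cong_sets)
  have inc: "incseq (\<lambda>n. \<integral>\<^sup>+ x. U n x \<partial>N)" for N :: "'a measure"
    using seq(3) by (auto simp: incseq_def le_fun_def intro!: nn_integral_mono)
  show ?case
    using seq by (simp add: image_comp SUP_apply nn_integral_monotone_convergence_SUP
      ennreal_SUP_sum[OF inc, symmetric])
qed

text \<open>Positive and negative parts of the real and imaginary parts; integrability for each
  single measure excludes differences of infinities.\<close>

lemma integral_sum_measure_cong:
  fixes M M' :: "'i \<Rightarrow> 'a measure" and f :: "'a \<Rightarrow> complex"
  assumes sets: "\<And>i. i \<in> I \<Longrightarrow> sets (M i) = sets B" "\<And>i. i \<in> I \<Longrightarrow> sets (M' i) = sets B"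
    and eq: "\<And>A. A \<in> sets B \<Longrightarrow> (\<Sum>i\<in>I. emeasure (M i) A) = (\<Sum>i\<in>I. emeasure (M' i) A)"
    and int: "\<And>i. i \<in> I \<Longrightarrow> integrable (M i) f" "\<And>i. i \<in> I \<Longrightarrow> integrable (M' i) f"
    and f: "f \<in> borel_measurable B"
  shows "(\<Sum>i\<in>I. \<integral>x. f x \<partial>M i) = (\<Sum>i\<in>I. \<integral>x. f x \<partial>M' i)"
proof -
  have real: "(\<Sum>i\<in>I. \<integral>x. g x \<partial>M i) = (\<Sum>i\<in>I. \<integral>x. g x \<partial>M' i)"
    if g: "g \<in> borel_measurable B" "\<And>i. i \<in> I \<Longrightarrow> integrable (M i) g" "\<And>i. i \<in> I \<Longrightarrow> integrable (M' i) g"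
    for g :: "'a \<Rightarrow> real"
  proof -
    have fin: "(\<integral>\<^sup>+ x. ennreal (g x) \<partial>N) < \<infinity>" "(\<integral>\<^sup>+ x. ennreal (- g x) \<partial>N) < \<infinity>"
      if "integrable N g" for N :: "'a measure"
      using that unfolding real_integrable_def by (auto simp: top.not_eq_extremum)
    have "enn2real (\<Sum>i\<in>I. \<integral>\<^sup>+ x. ennreal (h x) \<partial>M i) = enn2real (\<Sum>i\<in>I. \<integral>\<^sup>+ x. ennreal (h x) \<partial>M' i)"
      if "h \<in> borel_measurable B" for h
      using that by (subst nn_integral_sum_measure_cong[OF sets eq]) auto
    from this[of g] this[of "\<lambda>x. - g x"] show ?thesis
      using g fin by (simp add: real_lebesgue_integral_def sum_subtractf enn2real_sum)
  qed
  show ?thesis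
  proof (rule complex_eqI)
    show "Re (\<Sum>i\<in>I. \<integral>x. f x \<partial>M i) = Re (\<Sum>i\<in>I. \<integral>x. f x \<partial>M' i)"
      using real[of "\<lambda>x. Re (f x)"] int f by (simp add: integral_Re)
    show "Im (\<Sum>i\<in>I. \<integral>x. f x \<partial>M i) = Im (\<Sum>i\<in>I. \<integral>x. f x \<partial>M' i)"
      using real[of "\<lambda>x. Im (f x)"] int f by (simp add: integral_Im)
  qed
qed

text \<open>Gives access to the transformation formula and to Fubini: the convolution need not be
  sigma-finite, but the product measure behind it is.\<close>

lemma mult_conv_eq_distr:
  assumes "sigma_finite_measure \<nu>" and "sigma_finite_measure \<rho>"
    and sets_\<nu>: "sets \<nu> = sets borel" and sets_\<rho>: "sets \<rho> = sets borel"
  shows "\<nu> \<circledast> \<rho> = distr (\<rho> \<Otimes>\<^sub>M \<nu>) borel (\<lambda>(x, y). x * y)"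
proof (rule measure_eqI)
  note [measurable_cong] = sets_\<nu> sets_\<rho>
  show "sets (\<nu> \<circledast> \<rho>) = sets (distr (\<rho> \<Otimes>\<^sub>M \<nu>) borel (\<lambda>(x, y). x * y))"
    using sets.sigma_sets_eq[of "borel :: (real ^ 'a) measure"] by (simp add: mult_conv_def)
  fix B assume "B \<in> sets (\<nu> \<circledast> \<rho>)"
  then have B: "B \<in> sets borel"
    using sets.sigma_sets_eq[of "borel :: (real ^ 'a) measure"] by (simp add: mult_conv_def)
  have space: "space (\<rho> \<Otimes>\<^sub>M \<nu>) = UNIV"
    using sets_eq_imp_space_eq[OF sets_\<nu>] sets_eq_imp_space_eq[OF sets_\<rho>]
    by (simp add: space_pair_measure)
  have m: "(\<lambda>(x, y). x * y) \<in> \<rho> \<Otimes>\<^sub>M \<nu> \<rightarrow>\<^sub>M borel"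
    by measurable
  have "emeasure (distr (\<rho> \<Otimes>\<^sub>M \<nu>) borel (\<lambda>(x, y). x * y)) B =
      emeasure (\<rho> \<Otimes>\<^sub>M \<nu>) ((\<lambda>(x, y). x * y) -` B)"
    using emeasure_distr[OF m B] by (simp add: space)
  also have "\<dots> = (\<integral>\<^sup>+ x. emeasure \<nu> ((\<lambda>y. x * y) -` B) \<partial>\<rho>)"
    using measurable_sets[OF m B]
    by (subst sigma_finite_measure.emeasure_pair_measure_alt[OF assms(1)])
      (simp_all add: space vimage_def)
  finally show "emeasure (\<nu> \<circledast> \<rho>) B = emeasure (distr (\<rho> \<Otimes>\<^sub>M \<nu>) borel (\<lambda>(x, y). x * y)) B"
    by (simp add: emeasure_mult_conv[OF assms(1) sets_\<nu> sets_\<rho> B])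
qed

section \<open>Mellin transforms on coordinate faces\<close>

lemma vec_nth_measurable [measurable]: "(\<lambda>x :: real ^ 'd. x $ k) \<in> borel_measurable borel"
  by (intro borel_measurable_continuous_onI continuous_intros)

text \<open>The face \<open>S\<close> collects the coordinates that do not vanish; Mellin transforms are taken on each face
  separately.\<close>

definition face_fac :: "'d set \<Rightarrow> ('d \<Rightarrow> real) \<Rightarrow> 'd \<Rightarrow> real \<Rightarrow> complex" where
  "face_fac S \<theta> k t =
    (if k \<in> S then if t > 0 then cis (\<theta> k * ln t) else 0 else if t = 0 then 1 else 0)"

definition face_char :: "'d::finite set \<Rightarrow> ('d \<Rightarrow> real) \<Rightarrow> real ^ 'd \<Rightarrow> complex" where
  "face_char S \<theta> x = (\<Prod>k\<in>UNIV. face_fac S \<theta> k (x $ k))"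

definition log_char :: "('d::finite \<Rightarrow> real) \<Rightarrow> real ^ 'd \<Rightarrow> complex" where
  "log_char \<theta> x = (\<Prod>k\<in>UNIV. cis (\<theta> k * ln (x $ k)))"

lemma face_fac_measurable [measurable]: "face_fac S \<theta> k \<in> borel_measurable borel"
  unfolding face_fac_def[abs_def] cis_conv_exp by measurable

lemma norm_face_fac_le: "norm (face_fac S \<theta> k t) \<le> 1"
  by (simp add: face_fac_def)

lemma face_char_measurable [measurable]: "face_char S \<theta> \<in> borel_measurable borel"
  unfolding face_char_def[abs_def] by measurable

lemma log_char_measurable [measurable]: "log_char \<theta> \<in> borel_measurable borel"
  unfolding log_char_def[abs_def] cis_conv_exp by measurable

lemma norm_log_char [simp]: "norm (log_char \<theta> x) = 1"
  by (simp add: log_char_def prod_norm[symmetric])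

lemma norm_face_char_le: "norm (face_char S \<theta> x) \<le> 1"
  unfolding face_char_def prod_norm[symmetric] by (intro prod_le_1) (simp add: norm_face_fac_le)

lemma face_char_eq_0: "j \<in> S \<Longrightarrow> x $ j \<le> 0 \<Longrightarrow> face_char S \<theta> x = 0"
  unfolding face_char_def by (rule prod_zero) (auto simp: face_fac_def intro!: exI[of _ j])

text \<open>A factor with positive coordinates keeps the sign of every coordinate, so it preserves
  faces. Off \<open>S\<close> the frequencies must be 0, because \<open>log_char\<close> runs over
  all coordinates while \<open>face_char\<close> sees those of \<open>y\<close> in \<open>S\<close>
  only.\<close>

lemma face_char_mult:
  assumes x: "x \<in> pos_orthant" and \<theta>: "\<And>k. k \<notin> S \<Longrightarrow> \<theta> k = 0"
  shows "face_char S \<theta> (x * y) = log_char \<theta> x * face_char S \<theta> y"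
proof -
  have "face_fac S \<theta> k (x $ k * y $ k) = cis (\<theta> k * ln (x $ k)) * face_fac S \<theta> k (y $ k)" for k
  proof -
    have "x $ k > 0" using x by (simp add: pos_orthant_def)
    then show ?thesis
      using \<theta>[of k] by (auto simp: face_fac_def zero_less_mult_iff ln_mult distrib_left cis_mult)
  qed
  then show ?thesis
    by (simp add: face_char_def log_char_def times_vec_def prod.distrib)
qed

section \<open>The system seen from one fixed coordinate j\<close>

lemma pos_orthant_measurable [measurable]: "(pos_orthant :: (real ^ 'd::finite) set) \<in> sets borel"
  unfolding pos_orthant_def by measurable

text \<open>The data for a single index \<open>j\<close> of K, with \<open>a\<close> for its
  exponent. The weight \<open>x $ j powr a\<close> is blind to x_j = 0, so the conclusion reached in
  this context concerns the part of the measures where x_j > 0.\<close>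

locale mult_system =
  fixes a :: real and j :: "'d::finite"
    and \<rho> :: "real ^ 'd \<Rightarrow> (real ^ 'd) measure"
    and \<nu> :: "nat \<Rightarrow> real ^ 'd \<Rightarrow> (real ^ 'd) measure"
  assumes a: "a > 0"
    and \<rho>: "\<And>v. v \<in> signs \<Longrightarrow> sigma_finite_on pos_orthant (\<rho> v)"
    and \<nu>: "\<And>i v. i \<in> {1, 2} \<Longrightarrow> v \<in> signs \<Longrightarrow> sigma_finite_on nonneg_orthant (\<nu> i v)"
    and moment: "\<And>v. v \<in> signs \<Longrightarrow>
           (\<integral>\<^sup>+ x\<in>pos_orthant. ennreal (x $ j powr a) \<partial>\<rho> v) < \<infinity>"
    and tail: "\<And>i v. i \<in> {1, 2} \<Longrightarrow> v \<in> signs \<Longrightarrow>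
           (SUP s\<in>{0<..}. ennreal (s powr a) * emeasure (\<nu> i v) {x. x $ j > s}) < \<infinity>"
    and nonzero: "\<And>T \<theta>. (\<Sum>v\<in>signs. complex_of_real (sign_char T v) *
              (LINT x:pos_orthant|\<rho> v. complex_of_real (x $ j powr a) * log_char \<theta> x)) \<noteq> 0"
    and eq: "\<And>v B. v \<in> signs \<Longrightarrow> B \<in> sets borel \<Longrightarrow>
           (\<Sum>w\<in>signs. emeasure (\<nu> 1 w \<circledast> \<rho> (v * w)) B) =
           (\<Sum>w\<in>signs. emeasure (\<nu> 2 w \<circledast> \<rho> (v * w)) B)"
begin

lemma sets_\<nu>: "i \<in> {1, 2} \<Longrightarrow> v \<in> signs \<Longrightarrow> sets (\<nu> i v) = sets borel"
  and sigma_finite_\<nu>: "i \<in> {1, 2} \<Longrightarrow> v \<in> signs \<Longrightarrow> sigma_finite_measure (\<nu> i v)"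
  using \<nu> by (auto simp: sigma_finite_on_def)

lemma sets_\<rho>: "v \<in> signs \<Longrightarrow> sets (\<rho> v) = sets borel"
  and sigma_finite_\<rho>: "v \<in> signs \<Longrightarrow> sigma_finite_measure (\<rho> v)"
  using \<rho> by (auto simp: sigma_finite_on_def)

lemma AE_\<rho>: assumes "v \<in> signs" shows "AE x in \<rho> v. x \<in> pos_orthant"
proof (rule AE_I)
  show "emeasure (\<rho> v) (- pos_orthant) = 0" using \<rho>[OF assms] by (simp add: sigma_finite_on_def)
  show "- pos_orthant \<in> sets (\<rho> v)"
    unfolding sets_\<rho>[OF assms] by measurable
qed auto

text \<open>The tail decays like s to the power -a while the weight grows like s to the power a, so
  they balance on each slab. The constant is chosen before \<open>H\<close>, so that one constant
  per measure serves all faces and frequencies.\<close>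

lemma slab:
  assumes iv: "i \<in> {1, 2}" "v \<in> signs"
  shows "\<exists>D. \<forall>H. H \<in> borel_measurable borel \<longrightarrow>
    (\<forall>x. norm (H x) \<le> (if x $ j > 0 then x $ j powr a else 0)) \<longrightarrow>
    slab_bounded (\<nu> i v) (\<lambda>x. ln (x $ j)) H D"
proof -
  note [measurable_cong] = sets_\<nu>[OF iv]
  obtain C where C: "C \<ge> 0"
      "(SUP s\<in>{0<..}. ennreal (s powr a) * emeasure (\<nu> i v) {x. x $ j > s}) = ennreal C"
    using tail[OF iv] by (cases rule: ennreal_cases) auto
  have tail: "ennreal (s powr a) * emeasure (\<nu> i v) {x. x $ j > s} \<le> ennreal C" if "s > 0" for s
    unfolding C(2)[symmetric] using that by (intro SUP_upper) auto
  show ?thesis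
  proof (intro exI allI impI)
    fix H :: "real ^ 'd \<Rightarrow> complex"
    assume H [measurable]: "H \<in> borel_measurable borel"
      and H_le: "\<forall>x. norm (H x) \<le> (if x $ j > 0 then x $ j powr a else 0)"
    interpret sigma_finite_measure "\<nu> i v" by (rule sigma_finite_\<nu>[OF iv])
    show "slab_bounded (\<nu> i v) (\<lambda>x. ln (x $ j)) H (C * exp (2 * a))"
    proof
      show "(\<lambda>x. ln (x $ j)) \<in> borel_measurable (\<nu> i v)" "H \<in> borel_measurable (\<nu> i v)"
        by measurable
      show "C * exp (2 * a) \<ge> 0" using C by simp
      fix t :: real
      \<comment> \<open>The slab is closed at t but the tail condition is strict, so the tail starts
        one unit earlier; comparing the weight at t + 1 with the tail at t - 1 yields
        \<open>exp (2 * a)\<close>.\<close>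
      let ?s = "exp (t - 1)"
      have s: "?s powr a = exp (a * (t - 1))" by (simp add: powr_def)
      have "(\<integral>\<^sup>+ x. ennreal (norm (H x)) * indicator {t..t+1} (ln (x $ j)) \<partial>\<nu> i v) \<le>
          (\<integral>\<^sup>+ x. ennreal (exp (a * (t + 1))) * indicator {x. x $ j > ?s} x \<partial>\<nu> i v)"
      proof (rule nn_integral_mono)
        fix x
        show "ennreal (norm (H x)) * indicator {t..t+1} (ln (x $ j)) \<le>
            ennreal (exp (a * (t + 1))) * indicator {x. x $ j > ?s} x"
        proof (cases "x $ j > 0 \<and> ln (x $ j) \<in> {t..t+1}")
          case True
          then have "?s < x $ j" using exp_less_cancel_iff[of "t - 1" "ln (x $ j)"] by simp
          moreover have "norm (H x) \<le> exp (a * (t + 1))"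
            using True a H_le[rule_format, of x] by (auto simp: powr_def elim!: order_trans)
          ultimately show ?thesis using True by (simp add: ennreal_leI)
        next
          case False
          then have "H x = 0 \<or> ln (x $ j) \<notin> {t..t+1}" using H_le[rule_format, of x] by (auto split: if_splits)
          then show ?thesis by auto
        qed
      qed
      also have "\<dots> = ennreal (exp (a * (t + 1))) * emeasure (\<nu> i v) {x. x $ j > ?s}"
        by (rule nn_integral_cmult_indicator) measurable
      also have "exp (a * (t + 1)) = exp (2 * a) * ?s powr a"
        unfolding s by (simp add: exp_add[symmetric] algebra_simps)
      also have "ennreal (exp (2 * a) * ?s powr a) * emeasure (\<nu> i v) {x. x $ j > ?s} =
          ennreal (exp (2 * a)) * (ennreal (?s powr a) * emeasure (\<nu> i v) {x. x $ j > ?s})"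
        by (simp add: ennreal_mult mult.assoc)
      also have "\<dots> \<le> ennreal (exp (2 * a)) * ennreal C"
        by (intro mult_left_mono tail) auto
      also have "\<dots> = ennreal (C * exp (2 * a))"
        using C by (subst ennreal_mult[symmetric]) (auto simp: mult.commute)
      finally show "(\<integral>\<^sup>+ x. ennreal (norm (H x)) * indicator {t..t+1} (ln (x $ j)) \<partial>\<nu> i v) \<le>
          ennreal (C * exp (2 * a))" .
    qed
  qed
qed

lemma integrable_moment:
  assumes v: "v \<in> signs"
  shows "integrable (\<rho> v) (\<lambda>x. complex_of_real (x $ j powr a) * log_char \<theta> x)"
proof (rule integrableI_bounded)
  note [measurable_cong] = sets_\<rho>[OF v]
  show "(\<lambda>x. complex_of_real (x $ j powr a) * log_char \<theta> x) \<in> borel_measurable (\<rho> v)"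
    by measurable
  have "(\<integral>\<^sup>+ x. ennreal (norm (complex_of_real (x $ j powr a) * log_char \<theta> x)) \<partial>\<rho> v) =
      (\<integral>\<^sup>+ x\<in>pos_orthant. ennreal (x $ j powr a) \<partial>\<rho> v)"
    using AE_\<rho>[OF v] by (intro nn_integral_cong_AE) (auto simp: norm_mult)
  then show "(\<integral>\<^sup>+ x. ennreal (norm (complex_of_real (x $ j powr a) * log_char \<theta> x)) \<partial>\<rho> v) < \<infinity>"
    using moment[OF v] by simp
qed

lemma nonzero':
  "(\<Sum>v\<in>signs. complex_of_real (sign_char T v) *
    (\<integral>x. complex_of_real (x $ j powr a) * log_char \<theta> x \<partial>\<rho> v)) \<noteq> 0"
proof -
  have "(LINT x:pos_orthant|\<rho> v. complex_of_real (x $ j powr a) * log_char \<theta> x) =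
      (\<integral>x. complex_of_real (x $ j powr a) * log_char \<theta> x \<partial>\<rho> v)" if v: "v \<in> signs" for v
  proof -
    note [measurable_cong] = sets_\<rho>[OF v]
    show ?thesis
      unfolding set_lebesgue_integral_def
      by (rule integral_cong_AE, measurable, measurable, use AE_\<rho>[OF v] in \<open>auto elim!: eventually_mono\<close>)
  qed
  then show ?thesis using nonzero[of T \<theta>] by simp
qed

definition tail_const :: "nat \<Rightarrow> real ^ 'd \<Rightarrow> real" where
  "tail_const i v = (SOME D. \<forall>H. H \<in> borel_measurable borel \<longrightarrow>
    (\<forall>x. norm (H x) \<le> (if x $ j > 0 then x $ j powr a else 0)) \<longrightarrow>
    slab_bounded (\<nu> i v) (\<lambda>x. ln (x $ j)) H D)"

lemma slab_bounded_tail_const: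
  assumes "i \<in> {1, 2}" "v \<in> signs" "H \<in> borel_measurable borel"
    "\<And>x. norm (H x) \<le> (if x $ j > 0 then x $ j powr a else 0)"
  shows "slab_bounded (\<nu> i v) (\<lambda>x. ln (x $ j)) H (tail_const i v)"
  using someI_ex[OF slab[OF assms(1,2)]] assms(3,4) unfolding tail_const_def by blast

definition face_weight :: "'d set \<Rightarrow> ('d \<Rightarrow> real) \<Rightarrow> real ^ 'd \<Rightarrow> complex" where
  "face_weight S \<theta> x = complex_of_real (x $ j powr a) * face_char S \<theta> x"

lemma face_weight_measurable [measurable]: "face_weight S \<theta> \<in> borel_measurable borel"
  unfolding face_weight_def by measurable

lemma norm_face_weight_le:
  "j \<in> S \<Longrightarrow> norm (face_weight S \<theta> x) \<le> (if x $ j > 0 then x $ j powr a else 0)"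
  using norm_face_char_le[of S \<theta> x] face_char_eq_0[of j S x \<theta>]
  by (auto simp: face_weight_def norm_mult mult_left_le)

text \<open>Turns multiplicative convolution into additive convolution along the logarithm of x_j,
  everything else splitting into a factor in y and a factor in z. Where \<open>y $ j\<close> is not
  positive, both sides are 0, whatever \<open>ln\<close> returns.\<close>

lemma face_weight_mult:
  assumes jS: "j \<in> S" and \<theta>: "\<And>k. k \<notin> S \<Longrightarrow> \<theta> k = 0" and z: "z \<in> pos_orthant"
  shows "\<phi> (ln ((z * y) $ j)) * face_weight S \<theta> (z * y) =
    (\<phi> (ln (y $ j) + ln (z $ j)) * face_weight S \<theta> y) * (complex_of_real (z $ j powr a) * log_char \<theta> z)"
proof (cases "y $ j > 0")
  case True
  have "z $ j > 0" using z by (simp add: pos_orthant_def)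
  then have "ln ((z * y) $ j) = ln (y $ j) + ln (z $ j)" "(z * y) $ j powr a = z $ j powr a * y $ j powr a"
    using True by (simp_all add: times_vec_def ln_mult powr_mult)
  then show ?thesis
    using face_char_mult[OF z \<theta>, where y = y] by (simp add: face_weight_def mult_ac)
next
  case False
  then show ?thesis
    using face_char_mult[OF z \<theta>, where y = y] face_char_eq_0[OF jS, of y \<theta>] by (simp add: face_weight_def)
qed

text \<open>For fixed z the inner integral is a slab estimate with the centre moved by ln z_j, hence
  bounded uniformly in z; the remaining factor is integrable by the moment condition. That justifies
  Fubini.\<close>

lemma integral_mult_conv:
  assumes iw: "i \<in> {1, 2}" "w \<in> signs" and v: "v \<in> signs"
    and jS: "j \<in> S" and \<theta>: "\<And>k. k \<notin> S \<Longrightarrow> \<theta> k = 0"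
    and [measurable]: "\<phi> \<in> borel_measurable borel"
    and \<phi>: "\<And>y. norm (\<phi> y :: complex) \<le> C / (1 + (y - b)\<^sup>2)"
  shows "integrable (\<nu> i w \<circledast> \<rho> v) (\<lambda>p. \<phi> (ln (p $ j)) * face_weight S \<theta> p)"
    and "integrable (\<rho> v) (\<lambda>z. (\<integral>y. \<phi> (ln (y $ j) + ln (z $ j)) * face_weight S \<theta> y \<partial>\<nu> i w) *
      (complex_of_real (z $ j powr a) * log_char \<theta> z))"
    and "(\<integral>p. \<phi> (ln (p $ j)) * face_weight S \<theta> p \<partial>(\<nu> i w \<circledast> \<rho> v)) =
      (\<integral>z. (\<integral>y. \<phi> (ln (y $ j) + ln (z $ j)) * face_weight S \<theta> y \<partial>\<nu> i w) *
        (complex_of_real (z $ j powr a) * log_char \<theta> z) \<partial>\<rho> v)"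
proof -
  note [measurable_cong] = sets_\<nu>[OF iw] sets_\<rho>[OF v]
  interpret N: slab_bounded "\<nu> i w" "\<lambda>x. ln (x $ j)" "face_weight S \<theta>" "tail_const i w"
    using iw norm_face_weight_le[OF jS] by (intro slab_bounded_tail_const) measurable
  interpret R: sigma_finite_measure "\<rho> v" by (rule sigma_finite_\<rho>[OF v])
  interpret P: pair_sigma_finite "\<rho> v" "\<nu> i w" ..
  let ?\<Phi> = "\<lambda>p. \<phi> (ln (p $ j)) * face_weight S \<theta> p"
  let ?W = "\<lambda>z. complex_of_real (z $ j powr a) * log_char \<theta> z"
  let ?J = "\<lambda>z. \<integral>y. \<phi> (ln (y $ j) + ln (z $ j)) * face_weight S \<theta> y \<partial>\<nu> i w"
  have bound: "norm (\<phi> (y + c)) \<le> C / (1 + (y - (b - c))\<^sup>2)" for y c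
    using \<phi>[of "y + c"] by (simp add: algebra_simps)
  note distr = mult_conv_eq_distr[OF N.sigma_finite_measure_axioms R.sigma_finite_measure_axioms
    sets_\<nu>[OF iw] sets_\<rho>[OF v]]
  have AE: "AE z in \<rho> v. \<forall>y. ?\<Phi> (z * y) = (\<phi> (ln (y $ j) + ln (z $ j)) * face_weight S \<theta> y) * ?W z"
    using AE_\<rho>[OF v] by eventually_elim (intro allI face_weight_mult jS \<theta>)
  have mm: "(\<lambda>(z, y). ?\<Phi> (z * y)) \<in> borel_measurable (\<rho> v \<Otimes>\<^sub>M \<nu> i w)"
    using measurable_compose[OF borel_measurable_vec_times, of ?\<Phi> borel]
    by (simp add: case_prod_unfold cong: measurable_cong_sets)
  have int: "integrable (\<rho> v \<Otimes>\<^sub>M \<nu> i w) (\<lambda>(z, y). ?\<Phi> (z * y))"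
  proof (rule P.integrable_pairI[OF mm])
    show "integrable (\<rho> v) (\<lambda>z. 2 * C * tail_const i w * sq_sum * norm (?W z))"
      using integrable_moment[OF v] by (intro integrable_mult_right integrable_norm)
    show "AE z in \<rho> v. (\<integral>\<^sup>+ y. norm (case (z, y) of (z, y) \<Rightarrow> ?\<Phi> (z * y)) \<partial>\<nu> i w)
        \<le> ennreal (2 * C * tail_const i w * sq_sum * norm (?W z))"
      using AE
    proof eventually_elim
      fix z assume z: "\<forall>y. ?\<Phi> (z * y) = (\<phi> (ln (y $ j) + ln (z $ j)) * face_weight S \<theta> y) * ?W z"
      have "(\<integral>\<^sup>+ y. norm (case (z, y) of (z, y) \<Rightarrow> ?\<Phi> (z * y)) \<partial>\<nu> i w) =
          (\<integral>\<^sup>+ y. ennreal (norm (?W z)) * ennreal (norm (\<phi> (ln (y $ j) + ln (z $ j)) * face_weight S \<theta> y)) \<partial>\<nu> i w)"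
        by (rule nn_integral_cong)
          (simp only: z[rule_format] prod.case, subst ennreal_mult[symmetric],
            (rule norm_ge_zero)+, simp only: norm_mult mult_ac)
      also have "\<dots> = ennreal (norm (?W z)) * (\<integral>\<^sup>+ y. norm (\<phi> (ln (y $ j) + ln (z $ j)) * face_weight S \<theta> y) \<partial>\<nu> i w)"
        by (rule nn_integral_cmult) measurable
      also have "\<dots> \<le> ennreal (norm (?W z)) * ennreal (2 * C * tail_const i w * sq_sum)"
        by (intro mult_left_mono N.nn_integral_le[of "\<lambda>y. \<phi> (y + ln (z $ j))", OF bound]) auto
      also have "\<dots> = ennreal (2 * C * tail_const i w * sq_sum * norm (?W z))"
        by (subst ennreal_mult'[symmetric]) (auto simp: mult.commute)
      finally show "(\<integral>\<^sup>+ y. norm (case (z, y) of (z, y) \<Rightarrow> ?\<Phi> (z * y)) \<partial>\<nu> i w)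
        \<le> ennreal (2 * C * tail_const i w * sq_sum * norm (?W z))" .
    qed
  qed
  have inner: "AE z in \<rho> v. (\<integral>y. ?\<Phi> (z * y) \<partial>\<nu> i w) = ?J z * ?W z"
    using AE by eventually_elim (simp only: integral_mult_left_zero)
  have Jm: "(\<lambda>z. ?J z * ?W z) \<in> borel_measurable (\<rho> v)"
    by measurable
  have Jm': "(\<lambda>z. \<integral>y. ?\<Phi> (z * y) \<partial>\<nu> i w) \<in> borel_measurable (\<rho> v)"
    using P.integrable_fst[OF int] by auto
  have mt: "(\<lambda>(z, y). z * y) \<in> \<rho> v \<Otimes>\<^sub>M \<nu> i w \<rightarrow>\<^sub>M borel"
    by measurable
  show "integrable (\<nu> i w \<circledast> \<rho> v) ?\<Phi>"
    unfolding distr using int by (subst integrable_distr_eq[OF mt]) (auto simp: case_prod_unfold)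
  show "integrable (\<rho> v) (\<lambda>z. ?J z * ?W z)"
    using P.integrable_fst[OF int] integrable_cong_AE[OF Jm' Jm inner] by simp
  have "(\<integral>p. ?\<Phi> p \<partial>(\<nu> i w \<circledast> \<rho> v)) = (\<integral>q. (case q of (z, y) \<Rightarrow> ?\<Phi> (z * y)) \<partial>(\<rho> v \<Otimes>\<^sub>M \<nu> i w))"
    unfolding distr by (subst integral_distr[OF mt]) (auto simp: case_prod_unfold)
  also have "\<dots> = (\<integral>z. (\<integral>y. ?\<Phi> (z * y) \<partial>\<nu> i w) \<partial>\<rho> v)"
    using P.integral_fst[OF int] by simp
  also have "\<dots> = (\<integral>z. ?J z * ?W z \<partial>\<rho> v)"
    by (rule integral_cong_AE[OF Jm' Jm inner])
  finally show "(\<integral>p. ?\<Phi> p \<partial>(\<nu> i w \<circledast> \<rho> v)) = (\<integral>z. ?J z * ?W z \<partial>\<rho> v)" .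
qed

text \<open>Decoupling by a character: in the double sum over v and w, replace v by v * w. The two
  characters merge into that of v alone, and the inner sum over w is the difference of the two sides
  of the v-th equation of the system.\<close>

lemma sum_conv_eq_0:
  assumes jS: "j \<in> S" and \<theta>: "\<And>k. k \<notin> S \<Longrightarrow> \<theta> k = 0"
    and [measurable]: "\<phi> \<in> borel_measurable borel"
    and \<phi>: "\<And>y. norm (\<phi> y :: complex) \<le> C / (1 + (y - b)\<^sup>2)"
  shows "(\<Sum>v\<in>signs. \<integral>z. (\<Sum>w\<in>signs. complex_of_real (sign_char T w) *
      ((\<integral>y. \<phi> (ln (y $ j) + ln (z $ j)) * face_weight S \<theta> y \<partial>\<nu> 1 w) -
       (\<integral>y. \<phi> (ln (y $ j) + ln (z $ j)) * face_weight S \<theta> y \<partial>\<nu> 2 w))) *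
      (complex_of_real (sign_char T v) * (complex_of_real (z $ j powr a) * log_char \<theta> z)) \<partial>\<rho> v) = 0"
proof -
  note * = integral_mult_conv[OF _ _ _ jS \<theta> \<open>\<phi> \<in> borel_measurable borel\<close> \<phi>]
  let ?\<Phi> = "\<lambda>p. \<phi> (ln (p $ j)) * face_weight S \<theta> p"
  let ?W = "\<lambda>z. complex_of_real (z $ j powr a) * log_char \<theta> z"
  let ?J = "\<lambda>i w z. \<integral>y. \<phi> (ln (y $ j) + ln (z $ j)) * face_weight S \<theta> y \<partial>\<nu> i w"
  let ?c = "\<lambda>v. complex_of_real (sign_char T v)"
  define A where "A i w v = (\<integral>p. ?\<Phi> p \<partial>(\<nu> i w \<circledast> \<rho> v))" for i w v
  have "(\<integral>z. (\<Sum>w\<in>signs. ?c w * (?J 1 w z - ?J 2 w z)) * (?c v * ?W z) \<partial>\<rho> v) =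
      (\<Sum>w\<in>signs. ?c w * ?c v * (A 1 w v - A 2 w v))" if v: "v \<in> signs" for v
  proof -
    have "(\<integral>z. (\<Sum>w\<in>signs. ?c w * (?J 1 w z - ?J 2 w z)) * (?c v * ?W z) \<partial>\<rho> v) =
        (\<integral>z. (\<Sum>w\<in>signs. ?c w * ?c v * (?J 1 w z * ?W z - ?J 2 w z * ?W z)) \<partial>\<rho> v)"
      unfolding sum_distrib_right
      by (intro Bochner_Integration.integral_cong sum.cong refl) (simp only: algebra_simps)
    also have "\<dots> = (\<Sum>w\<in>signs. ?c w * ?c v * ((\<integral>z. ?J 1 w z * ?W z \<partial>\<rho> v) - (\<integral>z. ?J 2 w z * ?W z \<partial>\<rho> v)))"
      using *(2)[OF _ _ v] by (subst Bochner_Integration.integral_sum) (auto intro!: sum.cong)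
    also have "\<dots> = (\<Sum>w\<in>signs. ?c w * ?c v * (A 1 w v - A 2 w v))"
      unfolding A_def using *(3)[OF _ _ v] by (intro sum.cong refl) simp
    finally show ?thesis .
  qed
  then have "(\<Sum>v\<in>signs. \<integral>z. (\<Sum>w\<in>signs. ?c w * (?J 1 w z - ?J 2 w z)) * (?c v * ?W z) \<partial>\<rho> v) =
      (\<Sum>v\<in>signs. \<Sum>w\<in>signs. ?c w * ?c v * (A 1 w v - A 2 w v))"
    by (rule sum.cong[OF refl])
  also have "\<dots> = (\<Sum>w\<in>signs. \<Sum>v\<in>signs. ?c w * ?c v * (A 1 w v - A 2 w v))"
    by (rule sum.swap)
  also have "\<dots> = (\<Sum>w\<in>signs. \<Sum>v\<in>signs. ?c v * (A 1 w (v * w) - A 2 w (v * w)))"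
  proof (rule sum.cong[OF refl])
    fix w :: "real ^ 'd" assume w: "w \<in> signs"
    have "sign_char T w * sign_char T w = 1"
      using abs_sign_char[OF w, of T] by (metis abs_mult_self mult_1_right)
    then have cc: "?c w * (?c w * x) = x" for x
      by (simp add: mult.assoc[symmetric] of_real_mult[symmetric] del: of_real_mult)
    have "(\<Sum>v\<in>signs. ?c w * ?c v * (A 1 w v - A 2 w v)) =
        (\<Sum>v\<in>signs. ?c w * ?c (v * w) * (A 1 w (v * w) - A 2 w (v * w)))"
      by (rule sum.reindex_bij_betw[OF bij_betw_signs_mult[OF w], symmetric])
    also have "\<dots> = (\<Sum>v\<in>signs. ?c v * (A 1 w (v * w) - A 2 w (v * w)))"
      by (intro sum.cong refl) (simp add: sign_char_mult mult_ac cc)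
    finally show "(\<Sum>v\<in>signs. ?c w * ?c v * (A 1 w v - A 2 w v)) =
        (\<Sum>v\<in>signs. ?c v * (A 1 w (v * w) - A 2 w (v * w)))" .
  qed
  also have "\<dots> = (\<Sum>v\<in>signs. \<Sum>w\<in>signs. ?c v * (A 1 w (v * w) - A 2 w (v * w)))"
    by (rule sum.swap)
  also have "\<dots> = (\<Sum>v\<in>(signs :: (real ^ 'd) set). 0)"
  proof (rule sum.cong[OF refl])
    fix v :: "real ^ 'd" assume v: "v \<in> signs"
    have sets: "sets (\<nu> i w \<circledast> \<rho> u) = sets borel" for i w u
      using sets.sigma_sets_eq[of "borel :: (real ^ 'd) measure"] by (simp add: mult_conv_def)
    have "(\<Sum>w\<in>signs. A 1 w (v * w)) = (\<Sum>w\<in>signs. A 2 w (v * w))"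
      unfolding A_def
      by (rule integral_sum_measure_cong[where B = borel])
        (use sets eq[OF v] *(1) signs_mult[OF v] in auto)
    then show "(\<Sum>w\<in>signs. ?c v * (A 1 w (v * w) - A 2 w (v * w))) = 0"
      by (simp add: sum_distrib_left[symmetric] sum_subtractf)
  qed
  finally show ?thesis by simp
qed

text \<open>The Tauberian frequency s is absorbed into theta_j, so non-vanishing for all theta
  yields it for all s at once.\<close>

lemma log_char_shift:
  "cis (s * ln (z $ j)) * log_char \<theta> z = log_char (\<theta>(j := \<theta> j + s)) z"
proof -
  have "log_char \<eta> z = cis (\<eta> j * ln (z $ j)) * (\<Prod>k\<in>UNIV - {j}. cis (\<eta> k * ln (z $ k)))" for \<eta>
    unfolding log_char_def by (rule prod.remove) auto
  then show ?thesis
    by (simp add: cis_mult[symmetric] distrib_right mult_ac)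
qed

text \<open>The Tauberian theorem is applied once for every character \<open>T\<close>; inverting
  over the sign group then isolates the single index \<open>w\<close>.\<close>

lemma face_transform_eq:
  assumes jS: "j \<in> S" and \<theta>: "\<And>k. k \<notin> S \<Longrightarrow> \<theta> k = 0" and w: "w \<in> signs"
  shows "(\<integral>x. complex_of_real (fejer2 (ln (x $ j))) * face_weight S \<theta> x \<partial>\<nu> 1 w) =
    (\<integral>x. complex_of_real (fejer2 (ln (x $ j))) * face_weight S \<theta> x \<partial>\<nu> 2 w)"
proof -
  define b where "b i w = (\<integral>x. complex_of_real (fejer2 (ln (x $ j))) * face_weight S \<theta> x \<partial>\<nu> i w)" for i w
  have "(\<Sum>w\<in>signs. sign_char T w * (b 1 w - b 2 w)) = 0" for T
  proof -
    let ?c = "\<lambda>v. complex_of_real (sign_char T v)"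
    \<comment> \<open>The sign encodes the difference of the two families: the pieces of sigma are
      indexed by pairs (i, w), and those with i = 2 are subtracted.\<close>
    let ?e = "\<lambda>i::nat. if i = 1 then 1 else - 1 :: complex"
    let ?H = "\<lambda>(i, w) x. ?e i * ?c w * face_weight S \<theta> x"
    let ?W = "\<lambda>v z. ?c v * (complex_of_real (z $ j powr a) * log_char \<theta> z)"
    have expand: "(\<Sum>p\<in>{1, 2} \<times> signs. \<integral>x. g x * ?H p x \<partial>(case p of (i, w) \<Rightarrow> \<nu> i w)) =
        (\<Sum>w\<in>signs. ?c w * ((\<integral>x. g x * face_weight S \<theta> x \<partial>\<nu> 1 w) - (\<integral>x. g x * face_weight S \<theta> x \<partial>\<nu> 2 w)))"
      for g :: "real ^ 'd \<Rightarrow> complex"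
    proof -
      have "(\<integral>x. g x * ?H (i, w) x \<partial>\<nu> i w) = ?e i * ?c w * (\<integral>x. g x * face_weight S \<theta> x \<partial>\<nu> i w)" for i w
      proof -
        have "g x * ?H (i, w) x = ?e i * ?c w * (g x * face_weight S \<theta> x)" for x
          by simp
        then show ?thesis by (simp only: integral_mult_right_zero)
      qed
      then show ?thesis
        by (simp add: sum.cartesian_product' sum.distrib[symmetric] sum_subtractf[symmetric] right_diff_distrib)
    qed
    have "wiener_system ({1, 2} \<times> signs) (\<lambda>(i, w). \<nu> i w) (\<lambda>_ x. ln (x $ j)) ?H
        (\<lambda>(i, w). tail_const i w) signs \<rho> (\<lambda>_ z. ln (z $ j)) ?W"
    proof (rule wiener_system.intro)
      fix p :: "nat \<times> (real ^ 'd)" assume "p \<in> {1, 2} \<times> signs"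
      then obtain i w where p: "p = (i, w)" "i \<in> {1, 2}" "w \<in> signs" by auto
      have "slab_bounded (\<nu> i w) (\<lambda>x. ln (x $ j)) (?H (i, w)) (tail_const i w)"
      proof (rule slab_bounded_tail_const[OF p(2,3)])
        show "?H (i, w) \<in> borel_measurable borel" by simp
        show "norm (?H (i, w) x) \<le> (if x $ j > 0 then x $ j powr a else 0)" for x
        proof -
          have "norm (?H (i, w) x) = norm (face_weight S \<theta> x)"
            using abs_sign_char[OF p(3), of T] by (simp add: norm_mult)
          then show ?thesis using norm_face_weight_le[OF jS, of \<theta> x] by (simp only:)
        qed
      qed
      then show "slab_bounded (case p of (i, w) \<Rightarrow> \<nu> i w) (\<lambda>x. ln (x $ j)) (?H p) (case p of (i, w) \<Rightarrow> tail_const i w)"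
        by (simp add: p(1))
    next
      fix v :: "real ^ 'd" assume v: "v \<in> signs"
      note [measurable_cong] = sets_\<rho>[OF v]
      show "(\<lambda>z. ln (z $ j)) \<in> borel_measurable (\<rho> v)" by measurable
      show "integrable (\<rho> v) (?W v)" by (intro integrable_mult_right integrable_moment v)
    next
      fix \<phi> :: "real \<Rightarrow> complex" and C b
      assume \<phi>: "\<phi> \<in> borel_measurable borel" "\<And>y. norm (\<phi> y) \<le> C / (1 + (y - b)\<^sup>2)"
      show "(\<Sum>l\<in>signs. \<integral>z. (\<Sum>p\<in>{1, 2} \<times> signs. \<integral>x. \<phi> (ln (x $ j) + ln (z $ j)) * ?H p x
          \<partial>(case p of (i, w) \<Rightarrow> \<nu> i w)) * ?W l z \<partial>\<rho> l) = 0"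
        unfolding expand by (rule sum_conv_eq_0[OF jS \<theta> \<phi>])
    next
      fix s
      have "cis (s * ln (z $ j)) * ?W v z =
          ?c v * (complex_of_real (z $ j powr a) * log_char (\<theta>(j := \<theta> j + s)) z)" for v z
        unfolding log_char_shift[symmetric] by simp
      then show "(\<Sum>v\<in>signs. \<integral>z. cis (s * ln (z $ j)) * ?W v z \<partial>\<rho> v) \<noteq> 0"
        using nonzero'[of T "\<theta>(j := \<theta> j + s)"] by (simp only: integral_mult_right_zero not_False_eq_True)
    qed
    then have "(\<Sum>p\<in>{1, 2} \<times> signs. \<integral>x. complex_of_real (fejer2 (ln (x $ j))) * ?H p x
        \<partial>(case p of (i, w) \<Rightarrow> \<nu> i w)) = 0"
      by (rule wiener_system.sum_integral_fejer2_eq_0)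
    then show ?thesis
      unfolding expand b_def .
  qed
  from sign_char_inversion[OF this w] show ?thesis
    by (simp add: b_def)
qed

section \<open>From equal transforms to equal measures where x_j > 0\<close>

definition fejer_weight :: "real ^ 'd \<Rightarrow> real" where
  "fejer_weight x = (if x $ j > 0 then fejer2 (ln (x $ j)) * x $ j powr a else 0)"

lemma fejer_weight_measurable [measurable]: "fejer_weight \<in> borel_measurable borel"
  unfolding fejer_weight_def[abs_def] by measurable

lemma fejer_weight_nonneg: "fejer_weight x \<ge> 0"
  using fejer2_pos[of "ln (x $ j)"] by (simp add: fejer_weight_def)

lemma fejer_weight_pos: "x $ j > 0 \<Longrightarrow> fejer_weight x > 0"
  using fejer2_pos[of "ln (x $ j)"] by (simp add: fejer_weight_def)

text \<open>With h = 1 this says that the weighted measures are finite: the quadratic decay of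
  \<open>fejer2\<close> in ln x_j compensates for the infinite number of slabs.\<close>

lemma integrable_fejer_weight:
  assumes iw: "i \<in> {1, 2}" "w \<in> signs"
    and [measurable]: "h \<in> borel_measurable borel" and h: "\<And>x. norm (h x :: complex) \<le> 1"
  shows "integrable (\<nu> i w) (\<lambda>x. complex_of_real (fejer_weight x) * h x)"
proof -
  let ?H = "\<lambda>x. complex_of_real (if x $ j > 0 then x $ j powr a else 0) * h x"
  have "slab_bounded (\<nu> i w) (\<lambda>x. ln (x $ j)) ?H (tail_const i w)"
  proof (rule slab_bounded_tail_const[OF iw])
    show "?H \<in> borel_measurable borel" by measurable
    show "norm (?H x) \<le> (if x $ j > 0 then x $ j powr a else 0)" for x
      using h[of x] by (auto simp: norm_mult intro!: mult_left_le)
  qed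
  then have "integrable (\<nu> i w) (\<lambda>x. complex_of_real (fejer2 (ln (x $ j))) * ?H x)"
  proof (rule slab_bounded.integrable_weight)
    show "(\<lambda>y. complex_of_real (fejer2 y)) \<in> borel_measurable borel" by measurable
    show "norm (complex_of_real (fejer2 y)) \<le> 40 / (1 + (y - 0)\<^sup>2)" for y
      using fejer2_le[of y] fejer2_pos[of y] by simp
  qed
  moreover have "complex_of_real (fejer2 (ln (x $ j))) * ?H x = complex_of_real (fejer_weight x) * h x" for x
    by (simp add: fejer_weight_def)
  ultimately show ?thesis by (simp only:)
qed

text \<open>An intermediate stage: coordinates in \<open>U\<close> have already become intervals
  from 0 to \<open>b k\<close>, the others are still described by a face and a frequency.\<close>

definition mixed_fac :: "'d set \<Rightarrow> ('d \<Rightarrow> real) \<Rightarrow> 'd set \<Rightarrow> ('d \<Rightarrow> real) \<Rightarrow> 'd \<Rightarrow> real \<Rightarrow> complex" where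
  "mixed_fac U b S \<theta> k t = (if k \<in> U then indicator {0..b k} t else face_fac S \<theta> k t)"

lemma mixed_fac_measurable [measurable]: "mixed_fac U b S \<theta> k \<in> borel_measurable borel"
  unfolding mixed_fac_def by (cases "k \<in> U") simp_all

lemma norm_mixed_fac_le: "norm (mixed_fac U b S \<theta> k t) \<le> 1"
  using norm_face_fac_le[of S \<theta> k t] by (simp add: mixed_fac_def indicator_def)

text \<open>Fourier uniqueness turns the transform in one coordinate after the other into half-lines.\<close>

lemma integral_mixed_eq:
  assumes w: "w \<in> signs" and U: "finite U"
  shows "(\<integral>x. complex_of_real (fejer_weight x) * (\<Prod>k\<in>UNIV. mixed_fac U b S \<theta> k (x $ k)) \<partial>\<nu> 1 w) =
    (\<integral>x. complex_of_real (fejer_weight x) * (\<Prod>k\<in>UNIV. mixed_fac U b S \<theta> k (x $ k)) \<partial>\<nu> 2 w)"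
  using U
proof (induction U arbitrary: S \<theta> rule: finite_induct)
  case empty
  \<comment> \<open>\<open>face_transform_eq\<close> wants frequencies that vanish off
    \<open>S\<close>; \<open>face_fac\<close> reads them on \<open>S\<close> only, so resetting them
    changes nothing.\<close>
  let ?\<eta> = "\<lambda>k. if k \<in> S then \<theta> k else 0"
  have eq: "(\<Prod>k\<in>UNIV. mixed_fac {} b S \<theta> k (x $ k)) = face_char S ?\<eta> x" for x
    unfolding face_char_def by (intro prod.cong) (auto simp: mixed_fac_def face_fac_def)
  show ?case
  proof (cases "j \<in> S")
    case True
    have "complex_of_real (fejer_weight x) * face_char S ?\<eta> x =
        complex_of_real (fejer2 (ln (x $ j))) * face_weight S ?\<eta> x" for x
      using face_char_eq_0[OF True, of x ?\<eta>]
      by (cases "x $ j > 0") (auto simp: fejer_weight_def face_weight_def)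
    then show ?thesis
      unfolding eq using face_transform_eq[OF True _ w, of ?\<eta>] by simp
  next
    case False
    \<comment> \<open>On such a face x_j = 0, where the weight vanishes, so both integrals are
      0.\<close>
    have "complex_of_real (fejer_weight x) * (\<Prod>k\<in>UNIV. mixed_fac {} b S \<theta> k (x $ k)) = 0" for x
      using False by (cases "x $ j > 0")
        (auto simp: fejer_weight_def mixed_fac_def face_fac_def intro!: bexI[of _ j])
    then show ?thesis by (simp only: Bochner_Integration.integral_zero)
  qed
next
  case (insert k U)
  let ?Q = "\<lambda>x. \<Prod>l\<in>UNIV - {k}. mixed_fac U b S \<theta> l (x $ l)"
  let ?g = "\<lambda>x. complex_of_real (fejer_weight x)"
  have Q: "norm (?Q x) \<le> 1" for x
    unfolding prod_norm[symmetric] by (intro prod_le_1) (simp add: norm_mixed_fac_le)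
  have split: "(\<Prod>l\<in>UNIV. mixed_fac V b S' \<theta>' l (x $ l)) = mixed_fac V b S' \<theta>' k (x $ k) * ?Q x"
    if "V - {k} = U" "S' - {k} = S - {k}" "\<And>l. l \<noteq> k \<Longrightarrow> \<theta>' l = \<theta> l" for V S' \<theta>' x
  proof -
    have "(\<Prod>l\<in>UNIV. mixed_fac V b S' \<theta>' l (x $ l)) =
        mixed_fac V b S' \<theta>' k (x $ k) * (\<Prod>l\<in>UNIV - {k}. mixed_fac V b S' \<theta>' l (x $ l))"
      by (rule prod.remove) auto
    also have "(\<Prod>l\<in>UNIV - {k}. mixed_fac V b S' \<theta>' l (x $ l)) = ?Q x"
    proof (rule prod.cong[OF refl])
      fix l assume "l \<in> UNIV - {k}"
      then have "l \<in> V \<longleftrightarrow> l \<in> U" "l \<in> S' \<longleftrightarrow> l \<in> S" "\<theta>' l = \<theta> l" using that by auto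
      then show "mixed_fac V b S' \<theta>' l (x $ l) = mixed_fac U b S \<theta> l (x $ l)"
        by (simp add: mixed_fac_def face_fac_def)
    qed
    finally show ?thesis .
  qed
  let ?P = "\<lambda>f. (\<integral>x. ?g x * (f (x $ k) * ?Q x) \<partial>\<nu> 1 w) = (\<integral>x. ?g x * (f (x $ k) * ?Q x) \<partial>\<nu> 2 w)"
  have int: "integrable (\<nu> i w) (\<lambda>x. ?g x * (f (x $ k) * ?Q x))"
    if "i \<in> {1, 2}" and [measurable]: "f \<in> borel_measurable borel" and f: "\<And>t. norm (f t) \<le> 1" for i f
    using that(1) w
  proof (rule integrable_fejer_weight)
    show "(\<lambda>x. f (x $ k) * ?Q x) \<in> borel_measurable borel" by measurable
    show "norm (f (x $ k) * ?Q x) \<le> 1" for x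
      using f[of "x $ k"] Q[of x] by (simp add: norm_mult mult_le_one)
  qed
  let ?zero = "\<lambda>t::real. if t = 0 then 1 else 0 :: complex"
  let ?pos = "\<lambda>t::real. if t > 0 then 1 else 0 :: complex"
  \<comment> \<open>The induction hypothesis is available for every face and frequency: dropping k
    from \<open>S\<close> gives the part x_k = 0, while inserting k with frequency s gives the
    transform on x_k > 0, as needed for Fourier uniqueness in coordinate k.\<close>
  have zero: "?P ?zero"
  proof -
    have "mixed_fac U b (S - {k}) \<theta> k t = ?zero t" for t
      using insert.hyps(2) by (simp add: mixed_fac_def face_fac_def)
    moreover have "(\<Prod>l\<in>UNIV. mixed_fac U b (S - {k}) \<theta> l (x $ l)) =
        mixed_fac U b (S - {k}) \<theta> k (x $ k) * ?Q x" for x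
      using insert.hyps(2) by (intro split) auto
    ultimately show ?thesis
      using insert.IH[of "S - {k}" \<theta>] by (simp only:)
  qed
  have cis: "?P (\<lambda>t. cis (s * ln t) * ?pos t)" for s
  proof -
    have "mixed_fac U b (insert k S) (\<theta>(k := s)) k t = cis (s * ln t) * ?pos t" for t
      using insert.hyps(2) by (simp add: mixed_fac_def face_fac_def)
    moreover have "(\<Prod>l\<in>UNIV. mixed_fac U b (insert k S) (\<theta>(k := s)) l (x $ l)) =
        mixed_fac U b (insert k S) (\<theta>(k := s)) k (x $ k) * ?Q x" for x
      using insert.hyps(2) by (intro split) auto
    ultimately show ?thesis
      using insert.IH[of "insert k S" "\<theta>(k := s)"] by (simp only:)
  qed
  have half: "?P (\<lambda>t. indicator {..c} (ln t) * ?pos t)" for c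
  proof -
    have "(\<integral>x. indicator {..c} (ln (x $ k)) * (?g x * (?pos (x $ k) * ?Q x)) \<partial>\<nu> 1 w) =
        (\<integral>x. indicator {..c} (ln (x $ k)) * (?g x * (?pos (x $ k) * ?Q x)) \<partial>\<nu> 2 w)"
    proof (rule Fourier_unique)
      show "sigma_finite_measure (\<nu> 1 w)" "sigma_finite_measure (\<nu> 2 w)"
        by (auto intro: sigma_finite_\<nu> w)
      show "(\<lambda>x. ln (x $ k)) \<in> borel_measurable (\<nu> 1 w)" "(\<lambda>x. ln (x $ k)) \<in> borel_measurable (\<nu> 2 w)"
        using sets_\<nu>[OF _ w, of 1] sets_\<nu>[OF _ w, of 2] by (simp_all cong: measurable_cong_sets)
      show "integrable (\<nu> 1 w) (\<lambda>x. ?g x * (?pos (x $ k) * ?Q x))" by (rule int) auto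
      show "integrable (\<nu> 2 w) (\<lambda>x. ?g x * (?pos (x $ k) * ?Q x))" by (rule int) auto
      show "(\<integral>x. cis (s * ln (x $ k)) * (?g x * (?pos (x $ k) * ?Q x)) \<partial>\<nu> 1 w) =
          (\<integral>x. cis (s * ln (x $ k)) * (?g x * (?pos (x $ k) * ?Q x)) \<partial>\<nu> 2 w)" for s
        using cis[of s] by (simp only: mult.assoc mult.left_commute[of "cis _"])
    qed
    then show ?thesis by (simp only: mult.assoc mult.left_commute[of "indicator _ _"])
  qed
  have "?P (\<lambda>t. indicator {0..b k} t)"
  proof (cases "b k > 0")
    case True
    \<comment> \<open>The interval from 0 to b_k splits into the point 0 and the half-line of
      logarithms up to ln b_k.\<close>
    have ind: "?g x * (indicator {0..b k} (x $ k) * ?Q x) =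
        ?g x * (?zero (x $ k) * ?Q x) + ?g x * ((indicator {..ln (b k)} (ln (x $ k)) * ?pos (x $ k)) * ?Q x)" for x
      using True by (auto simp: indicator_def)
    have "integrable (\<nu> i w) (\<lambda>x. ?g x * (?zero (x $ k) * ?Q x))"
      "integrable (\<nu> i w) (\<lambda>x. ?g x * ((indicator {..ln (b k)} (ln (x $ k)) * ?pos (x $ k)) * ?Q x))"
      if "i \<in> {1, 2}" for i
      using int[OF that, of ?zero] int[OF that, of "\<lambda>t. indicator {..ln (b k)} (ln t) * ?pos t"]
      by (simp_all add: indicator_def norm_mult)
    then show ?thesis
      unfolding ind using zero half[of "ln (b k)"] by (simp only: Bochner_Integration.integral_add insertI1 insertI2)
  next
    case False
    show ?thesis
    proof (cases "b k = 0")
      case True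
      have "indicator {0..b k} t = ?zero t" for t using True by (auto simp: indicator_def)
      then show ?thesis using zero by (simp only:)
    next
      case False
      then have "indicator {0..b k} t = (0::complex)" for t
        using \<open>\<not> b k > 0\<close> by (auto simp: indicator_def)
      then show ?thesis by (simp only: mult_zero_left mult_zero_right Bochner_Integration.integral_zero)
    qed
  qed
  moreover have "mixed_fac (insert k U) b S \<theta> k t = indicator {0..b k} t" for t
    by (simp add: mixed_fac_def)
  moreover have "(\<Prod>l\<in>UNIV. mixed_fac (insert k U) b S \<theta> l (x $ l)) =
      mixed_fac (insert k U) b S \<theta> k (x $ k) * ?Q x" for x
    using insert.hyps(2) by (intro split) auto
  ultimately show ?case by (simp only:)
qed

text \<open>Once all coordinates are converted, the product is the indicator of the box from 0 to c,
  which agrees almost everywhere with \<open>{..c}\<close> for a measure on the nonnegative orthant.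
  These sets form an intersection-stable generator, on which the weighted measures are
  finite.\<close>

lemma density_fejer_weight_eq:
  assumes w: "w \<in> signs"
  shows "density (\<nu> 1 w) (\<lambda>x. ennreal (fejer_weight x)) = density (\<nu> 2 w) (\<lambda>x. ennreal (fejer_weight x))"
proof -
  have E: "emeasure (density (\<nu> i w) (\<lambda>x. ennreal (fejer_weight x))) {..c} =
      ennreal (Re (\<integral>x. complex_of_real (fejer_weight x) *
        (\<Prod>k\<in>UNIV. mixed_fac UNIV (\<lambda>k. c $ k) {} (\<lambda>_. 0) k (x $ k)) \<partial>\<nu> i w))"
    if i: "i \<in> {1, 2}" for i c
  proof -
    note [measurable_cong] = sets_\<nu>[OF i w]
    let ?h = "\<lambda>x. indicator {x. \<forall>k. x $ k \<in> {0..c $ k}} x :: real"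
    have [measurable]: "{x :: real ^ 'd. \<forall>k. x $ k \<in> {0..c $ k}} \<in> sets borel" by measurable
    have AE: "AE x in \<nu> i w. x \<in> nonneg_orthant"
    proof (rule AE_I)
      show "emeasure (\<nu> i w) (- nonneg_orthant) = 0" using \<nu>[OF i w] by (simp add: sigma_finite_on_def)
      show "- nonneg_orthant \<in> sets (\<nu> i w)"
        unfolding sets_\<nu>[OF i w] nonneg_orthant_def by measurable
    qed auto
    have prod: "(\<Prod>k\<in>UNIV. mixed_fac UNIV (\<lambda>k. c $ k) {} (\<lambda>_. 0) k (x $ k)) = complex_of_real (?h x)" for x :: "real ^ 'd"
      by (auto simp: mixed_fac_def indicator_def)
    have int: "integrable (\<nu> i w) (\<lambda>x. complex_of_real (fejer_weight x) * complex_of_real (?h x))"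
      using i w by (rule integrable_fejer_weight) (auto simp: indicator_def)
    then have int': "integrable (\<nu> i w) (\<lambda>x. fejer_weight x * ?h x)"
      unfolding of_real_mult[symmetric] complex_of_real_integrable_eq .
    have "emeasure (density (\<nu> i w) (\<lambda>x. ennreal (fejer_weight x))) {..c} =
        (\<integral>\<^sup>+ x. ennreal (fejer_weight x) * indicator {..c} x \<partial>\<nu> i w)"
      by (rule emeasure_density) (auto simp: sets_\<nu>[OF i w])
    also have "\<dots> = (\<integral>\<^sup>+ x. ennreal (fejer_weight x * ?h x) \<partial>\<nu> i w)"
      using AE by (intro nn_integral_cong_AE, eventually_elim)
        (auto simp: indicator_def nonneg_orthant_def less_eq_vec_def)
    also have "\<dots> = ennreal (\<integral>x. fejer_weight x * ?h x \<partial>\<nu> i w)"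
      using int' by (rule nn_integral_eq_integral) (simp add: fejer_weight_nonneg)
    finally show ?thesis
      unfolding prod of_real_mult[symmetric] by (simp only: integral_complex_of_real Re_complex_of_real)
  qed
  show ?thesis
  proof (rule measure_eqI_generator_eq)
    let ?E = "range (\<lambda>c :: real ^ 'd. {..c})"
    have inf: "{..x} \<inter> {..y} = {..inf x y}" for x y :: "real ^ 'd"
      by auto
    show "Int_stable ?E"
      unfolding Int_stable_def by (auto simp: inf)
    show "?E \<subseteq> Pow UNIV" by simp
    show "emeasure (density (\<nu> 1 w) (\<lambda>x. ennreal (fejer_weight x))) X =
        emeasure (density (\<nu> 2 w) (\<lambda>x. ennreal (fejer_weight x))) X" if X: "X \<in> ?E" for X
    proof -
      obtain c where c: "X = {..c}" using X by blast
      show ?thesis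
        unfolding c E[OF insertI1] E[OF insertI2[OF singletonI]] integral_mixed_eq[OF w finite] ..
    qed
    have borel: "sets (borel :: (real ^ 'd) measure) = sigma_sets UNIV ?E"
      unfolding borel_eq_atMost by simp
    show "sets (density (\<nu> 1 w) (\<lambda>x. ennreal (fejer_weight x))) = sigma_sets UNIV ?E"
      "sets (density (\<nu> 2 w) (\<lambda>x. ennreal (fejer_weight x))) = sigma_sets UNIV ?E"
      using w by (simp_all add: sets_\<nu> borel)
    let ?A = "\<lambda>n::nat. {..(\<chi> k. real n) :: real ^ 'd}"
    show "range ?A \<subseteq> ?E" by auto
    show "(\<Union>n. ?A n) = UNIV"
    proof (intro set_eqI iffI UNIV_I)
      fix x :: "real ^ 'd"
      obtain n where "norm x \<le> real n" using real_arch_simple by blast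
      then have "x $ k \<le> real n" for k
        using component_le_norm_cart[of x k] by linarith
      then show "x \<in> (\<Union>n. ?A n)" by (auto simp: less_eq_vec_def)
    qed
    show "emeasure (density (\<nu> 1 w) (\<lambda>x. ennreal (fejer_weight x))) (?A n) \<noteq> \<infinity>" for n
      by (simp add: E)
  qed
qed

text \<open>The weight is strictly positive where x_j > 0, hence it can be divided out again
  there.\<close>

lemma emeasure_eq:
  assumes w: "w \<in> signs" and B: "B \<in> sets borel" "B \<subseteq> {x. x $ j > 0}"
  shows "emeasure (\<nu> 1 w) B = emeasure (\<nu> 2 w) B"
proof -
  have "emeasure (\<nu> i w) B =
      (\<integral>\<^sup>+ x. ennreal (1 / fejer_weight x) * indicator B x \<partial>density (\<nu> i w) (\<lambda>x. ennreal (fejer_weight x)))"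
    if i: "i \<in> {1, 2}" for i
  proof -
    note [measurable_cong] = sets_\<nu>[OF i w]
    note [measurable] = B(1)
    have "(\<integral>\<^sup>+ x. ennreal (1 / fejer_weight x) * indicator B x \<partial>density (\<nu> i w) (\<lambda>x. ennreal (fejer_weight x))) =
        (\<integral>\<^sup>+ x. ennreal (fejer_weight x) * (ennreal (1 / fejer_weight x) * indicator B x) \<partial>\<nu> i w)"
      by (rule nn_integral_density) measurable
    also have "\<dots> = (\<integral>\<^sup>+ x. indicator B x \<partial>\<nu> i w)"
    proof (rule nn_integral_cong)
      fix x
      show "ennreal (fejer_weight x) * (ennreal (1 / fejer_weight x) * indicator B x) = indicator B x"
      proof (cases "x \<in> B")
        case True
        then have "fejer_weight x > 0" using B(2) by (auto intro: fejer_weight_pos)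
        then show ?thesis
          using True by (simp add: ennreal_mult[symmetric])
      qed simp
    qed
    also have "\<dots> = emeasure (\<nu> i w) B"
      by (rule nn_integral_indicator) measurable
    finally show ?thesis by simp
  qed
  then show ?thesis
    using density_fejer_weight_eq[OF w] by simp
qed

end

section \<open>Assembling the coordinates of K\<close>

theorem theorem2p2:
  fixes \<alpha> :: "'d::finite \<Rightarrow> real"
    and \<rho> :: "real ^ 'd \<Rightarrow> (real ^ 'd) measure"
    and \<nu> :: "nat \<Rightarrow> real ^ 'd \<Rightarrow> (real ^ 'd) measure"
    and K :: "'d set"
  assumes "\<And>j. \<alpha> j > 0"
    and "\<And>v. v \<in> signs \<Longrightarrow> sigma_finite_on pos_orthant (\<rho> v)"
    and "\<And>i v. i \<in> {1, 2} \<Longrightarrow> v \<in> signs \<Longrightarrow> sigma_finite_on nonneg_orthant (\<nu> i v)"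
    and "K \<noteq> {}"
    and "\<And>i v. i \<in> {1, 2} \<Longrightarrow> v \<in> signs \<Longrightarrow> emeasure (\<nu> i v) {x. \<forall>k\<in>K. x $ k = 0} = 0"
    and "\<And>v j. v \<in> signs \<Longrightarrow> j \<in> K \<Longrightarrow>
           (\<integral>\<^sup>+ x\<in>pos_orthant. ennreal (x $ j powr \<alpha> j) \<partial>\<rho> v) < \<infinity>"
    and "\<And>i v j. i \<in> {1, 2} \<Longrightarrow> v \<in> signs \<Longrightarrow> j \<in> K \<Longrightarrow>
           (SUP s\<in>{0<..}. ennreal (s powr \<alpha> j) * emeasure (\<nu> i v) {x. x $ j > s}) < \<infinity>"
    and "\<And>(j :: 'd) (m :: 'd \<Rightarrow> nat) (\<theta> :: 'd \<Rightarrow> real). j \<in> K \<Longrightarrow> (\<And>k. m k \<in> {0, 1}) \<Longrightarrow>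
           (\<Sum>v\<in>signs. complex_of_real (\<Prod>k\<in>UNIV. (v $ k) ^ m k) *
              (LINT x:pos_orthant|\<rho> v. complex_of_real (x $ j powr \<alpha> j) *
                 (\<Prod>k\<in>UNIV. complex_of_real (x $ k) powr (\<i> * complex_of_real (\<theta> k))))) \<noteq> 0"
    and "\<And>v B. v \<in> signs \<Longrightarrow> B \<in> sets borel \<Longrightarrow>
           (\<Sum>w\<in>signs. emeasure (\<nu> 1 w \<circledast> \<rho> (v * w)) B) =
           (\<Sum>w\<in>signs. emeasure (\<nu> 2 w \<circledast> \<rho> (v * w)) B)"
  shows "\<forall>v\<in>signs. \<nu> 1 v = \<nu> 2 v"
proof
  fix w :: "real ^ 'd" assume w: "w \<in> signs"
  have sets: "sets (\<nu> i w) = sets borel" if "i \<in> {1, 2}" for i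
    using assms(3)[OF that w] by (simp add: sigma_finite_on_def)
  have system: "mult_system (\<alpha> j) j \<rho> \<nu>" if j: "j \<in> K" for j
  proof (rule mult_system.intro)
    fix T :: "'d set" and \<theta> :: "'d \<Rightarrow> real"
    \<comment> \<open>The exponents m_k in {0, 1} are the indicator of \<open>T\<close>, which turns
      their monomial into \<open>sign_char T\<close>.\<close>
    let ?m = "\<lambda>k. if k \<in> T then 1 else 0 :: nat"
    have "(\<Prod>k\<in>UNIV. (v $ k) ^ ?m k) = sign_char T v" for v :: "real ^ 'd"
    proof -
      have "(\<Prod>k\<in>UNIV. (v $ k) ^ ?m k) = (\<Prod>k\<in>UNIV. if k \<in> T then v $ k else 1)"
        by (intro prod.cong) auto
      then show ?thesis by (simp add: sign_char_def prod.If_cases)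
    qed
    moreover have "(LINT x:pos_orthant|\<rho> v. complex_of_real (x $ j powr \<alpha> j) *
        (\<Prod>k\<in>UNIV. complex_of_real (x $ k) powr (\<i> * complex_of_real (\<theta> k)))) =
        (LINT x:pos_orthant|\<rho> v. complex_of_real (x $ j powr \<alpha> j) * log_char \<theta> x)" for v
    proof -
      have "(\<Prod>k\<in>UNIV. complex_of_real (x $ k) powr (\<i> * complex_of_real (\<theta> k))) = log_char \<theta> x"
        if "x \<in> pos_orthant" for x
        unfolding log_char_def
      proof (rule prod.cong[OF refl])
        fix k
        have "x $ k > 0" using that by (simp add: pos_orthant_def)
        then show "complex_of_real (x $ k) powr (\<i> * complex_of_real (\<theta> k)) = cis (\<theta> k * ln (x $ k))"
          by (simp add: powr_def Ln_of_real cis_conv_exp mult_ac)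
      qed
      then show ?thesis
        unfolding set_lebesgue_integral_def
        by (intro Bochner_Integration.integral_cong) (auto simp: indicator_def)
    qed
    ultimately show "(\<Sum>v\<in>signs. complex_of_real (sign_char T v) *
        (LINT x:pos_orthant|\<rho> v. complex_of_real (x $ j powr \<alpha> j) * log_char \<theta> x)) \<noteq> 0"
      using assms(8)[OF j, of ?m \<theta>] by simp
  next
    show "\<alpha> j > 0" by (rule assms(1))
  next
    fix v :: "real ^ 'd" assume v: "v \<in> signs"
    show "sigma_finite_on pos_orthant (\<rho> v)" by (rule assms(2)[OF v])
    show "(\<integral>\<^sup>+ x\<in>pos_orthant. ennreal (x $ j powr \<alpha> j) \<partial>\<rho> v) < \<infinity>" by (rule assms(6)[OF v j])
    show "sigma_finite_on nonneg_orthant (\<nu> i v)" if "i \<in> {1, 2}" for i by (rule assms(3)[OF that v])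
    show "(SUP s\<in>{0<..}. ennreal (s powr \<alpha> j) * emeasure (\<nu> i v) {x. x $ j > s}) < \<infinity>"
      if "i \<in> {1, 2}" for i by (rule assms(7)[OF that v j])
    show "(\<Sum>w\<in>signs. emeasure (\<nu> 1 w \<circledast> \<rho> (v * w)) B) = (\<Sum>w\<in>signs. emeasure (\<nu> 2 w \<circledast> \<rho> (v * w)) B)"
      if "B \<in> sets borel" for B by (rule assms(9)[OF v that])
  qed
  \<comment> \<open>Split off the region x_j > 0, settled by the system for j; what remains of B is
    covered by the other indices of J.\<close>
  have step: "emeasure (\<nu> 1 w) B = emeasure (\<nu> 2 w) B"
    if "finite J" "J \<subseteq> K" "B \<in> sets borel" "B \<subseteq> {x. \<exists>k\<in>J. x $ k > 0}" for J B
    using that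
  proof (induction J arbitrary: B rule: finite_induct)
    case (insert j J)
    let ?X = "{x :: real ^ 'd. x $ j > 0}"
    have X: "?X \<in> sets borel" by measurable
    have B: "(B \<inter> ?X) \<union> (B - ?X) = B" "(B \<inter> ?X) \<inter> (B - ?X) = {}" by auto
    have meas: "B \<inter> ?X \<in> sets borel" "B - ?X \<in> sets borel"
      using insert.prems X by auto
    have "emeasure (\<nu> i w) B = emeasure (\<nu> i w) (B \<inter> ?X) + emeasure (\<nu> i w) (B - ?X)" if "i \<in> {1, 2}" for i
      using plus_emeasure[of "B \<inter> ?X" "\<nu> i w" "B - ?X"] meas unfolding sets[OF that] B by simp
    moreover have "emeasure (\<nu> 1 w) (B \<inter> ?X) = emeasure (\<nu> 2 w) (B \<inter> ?X)"
      using insert.prems by (intro mult_system.emeasure_eq[OF system] w meas) auto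
    moreover have "emeasure (\<nu> 1 w) (B - ?X) = emeasure (\<nu> 2 w) (B - ?X)"
      using insert.prems by (intro insert.IH meas) auto
    ultimately show ?case by simp
  qed simp
  show "\<nu> 1 w = \<nu> 2 w"
  proof (rule measure_eqI)
    show "sets (\<nu> 1 w) = sets (\<nu> 2 w)" using sets by simp
    fix B assume "B \<in> sets (\<nu> 1 w)"
    then have B: "B \<in> sets borel" using sets by simp
    \<comment> \<open>Within the nonnegative orthant, the complement of this set is the null set of
      condition (a), so nothing is lost by intersecting with it.\<close>
    let ?X = "{x :: real ^ 'd. \<exists>k\<in>K. x $ k > 0}"
    have X: "?X \<in> sets borel" by measurable
    have "emeasure (\<nu> i w) B = emeasure (\<nu> i w) (B \<inter> ?X)" if i: "i \<in> {1, 2}" for i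
    proof (rule emeasure_eq_AE)
      have "AE x in \<nu> i w. x \<notin> {x. \<forall>k\<in>K. x $ k = 0}"
      proof (rule AE_not_in)
        have "{x :: real ^ 'd. \<forall>k\<in>K. x $ k = 0} \<in> sets borel" by measurable
        then show "{x. \<forall>k\<in>K. x $ k = 0} \<in> null_sets (\<nu> i w)"
          using assms(5)[OF i w] sets[OF i] by (auto simp: null_sets_def)
      qed
      moreover have "AE x in \<nu> i w. x \<notin> - nonneg_orthant"
      proof (rule AE_not_in)
        have "- nonneg_orthant \<in> sets (borel :: (real ^ 'd) measure)"
          unfolding nonneg_orthant_def by measurable
        then show "- nonneg_orthant \<in> null_sets (\<nu> i w)"
          using assms(3)[OF i w] by (auto simp: null_sets_def sigma_finite_on_def)
      qed
      ultimately show "AE x in \<nu> i w. x \<in> B \<longleftrightarrow> x \<in> B \<inter> ?X"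
        by eventually_elim (auto simp: nonneg_orthant_def less_le)
    qed (use B X sets[OF i] in auto)
    moreover have "emeasure (\<nu> 1 w) (B \<inter> ?X) = emeasure (\<nu> 2 w) (B \<inter> ?X)"
      using B X by (intro step[of K]) auto
    ultimately show "emeasure (\<nu> 1 w) B = emeasure (\<nu> 2 w) B" by simp
  qed
qed

end
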